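(* Let $X$ be a Banach space and let $(M,N)$ be a lower semi-Fredholm pair of closed subspaces of $X$. Let $\mathbb{N}'\subset\mathbb{N}$ be infinite and let $(M_n)_{n\in\mathbb{N}'}$, $(N_n)_{n\in\mathbb{N}'}$ be two sequences of nonzero closed subspaces of $X$. Set $$\mathcal{FSS}\lambda_M=\mathcal{FSS}\lambda_{\mathbb{N}'}[M_n,M],\quad \mathcal{FSS}\lambda_N=\mathcal{FSS}\lambda_{\mathbb{N}'}[N_n,N],\quad \mathcal{SS}\lambda_M=\mathcal{SS}\lambda_{\mathbb{N}'}[M_n,M],\quad \mathcal{SS}\lambda_N=\mathcal{SS}\lambda_{\mathbb{N}'}[N_n,N].$$ Then: 1. Let $\mathcal{FSS}\omega = 2\left(\min(\mathcal{FSS}\lambda_M,\mathcal{FSS}\lambda_N)+\varphi(M,N)\,(\mathcal{FSS}\lambda_M+\mathcal{FSS}\lambda_N)\right)$. If $\mathcal{FSS}\omega<1/2$, then for all large enough $n\in\mathbb{N}'$ the pairs $(M_n,N_n)$ are lower semi-Fredholm, and $\varlimsup_{n\in\mathbb{N}'}\alpha(M_n,N_n)<\infty$. 2. Let $\mathcal{SS}\omega = 2\left(\min(\mathcal{SS}\lambda_M,\mathcal{SS}\lambda_N)+\varphi(M,N)\,(\mathcal{SS}\lambda_M+\mathcal{SS}\lambda_N)\right)$. If $\mathcal{SS}\omega<1/2$, then for all large enough $n\in\mathbb{N}'$ the pairs $(M_n,N_n)$ are lower semi-Fredholm.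
   Context: Conventions: $\mathbb{N}'$ is an infinite subset of $\mathbb{N}$, $\mathbb{N}''$ an infinite subset of $\mathbb{N}'$, $\mathbb{N}'''$ an infinite subset of $\mathbb{N}''$, etc.; limits are taken along these index sets. $\theta$ is the null element. Dimensions are finite numbers or $\infty$. Uniform $\lambda$-adjustment. Let $(M_n)_{\mathbb{N}'}$, $(P_n)_{\mathbb{N}'}$ be sequences of closed subspaces of a Banach space $X$ with $M_n\neq\{\theta\}$ for all $n$, and let $\lambda\ge 0$. $(M_n)_{\mathbb{N}'}$ is lower uniformly $\lambda$-adjusted with $(P_n)_{\mathbb{N}'}$ if for every $\eta>0$, every infinite $\mathbb{N}''\subset\mathbb{N}'$ and all unit vectors $x_n\in M_n$ ($n\in\mathbb{N}''$), there exist an infinite $\mathbb{N}'''\subset\mathbb{N}''$, vectors $y_n\in P_n$ ($n\in\mathbb{N}'''$) and a vector $z\in X$ such that $\varlimsup_{n\in\mathbb{N}'''}\|x_n-y_n-z\|\le\lambda+\eta$. $\lambda_{\mathbb{N}'}[M_n,P_n]$ is the infimum of all such $\lambda$. Strictly singular uniform $\lambda$-adjustment. For the same data, $\mathcal{SS}\lambda_{\mathbb{N}'}[M_n,P_n]$ is the infimum of all $\lambda\ge0$ such that: for every infinite $\mathbb{N}''\subset\mathbb{N}'$ and all closed subspaces $K_n\subset M_n$ with $\dim K_n=\infty$ ($n\in\mathbb{N}''$), there exist an infinite $\mathbb{N}'''\subset\mathbb{N}''$ and closed subspaces $L_n\subset K_n$ with $\dim L_n=\infty$ ($n\in\mathbb{N}'''$)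 such that $\lambda_{\mathbb{N}'''}[L_n,P_n]\le\lambda$. Finitely strictly singular uniform $\lambda$-adjustment. $\mathcal{FSS}\lambda_{\mathbb{N}'}[M_n,P_n]$ is the infimum of all $\lambda\ge0$ such that: for every infinite $\mathbb{N}''\subset\mathbb{N}'$ and all subspaces $K_n\subset M_n$ with $\dim K_n<\infty$ ($n\in\mathbb{N}''$) and $\lim_{n\in\mathbb{N}''}\dim K_n=\infty$, there exist an infinite $\mathbb{N}'''\subset\mathbb{N}''$ and nonzero subspaces $L_n\subset K_n$ ($n\in\mathbb{N}'''$) with $\lim_{n\in\mathbb{N}'''}\dim L_n=\infty$ and $\lambda_{\mathbb{N}'''}[L_n,P_n]\le\lambda$. If $P_n=P$ for all $n$ one writes $P$ in place of $P_n$. A pair $(M,N)$ of closed subspaces of $X$ is lower semi-Fredholm if $M+N$ is closed and the lower defect number $\alpha(M,N):=\dim(M\cap N)$ is finite. The number $\varphi(M,N)$. Let $(M,N)$ be lower semi-Fredholm. For a closed subspace $S$ with $M+N=(M\cap N)\oplus S$, the map $\Phi:(M\cap S)\times(M\cap N)\times(N\cap S)\to M+N$, $\Phi(u,t,v)=u+t+v$, is a continuous bijection of Banach spaces, where the product carries the norm $\max\{\|u\|,\|t\|,\|v\|\}$; set $\varphi_S(M,N):=\|\Phi^{-1}\|$. Then $\varphi(M,N):=\inf\{\varphi_S(M,N)\mid S \text{ closed},\ M+N=(M\cap N)\oplus S\}$. *)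

theory Defs
  imports "HOL-Analysis.Analysis"
begin

text \<open>
  Banach spaces over the real or the complex field are treated simultaneously. The underlying real
  Banach space is the type \<open>'a\<close>; the scalar multiplication by the field \<open>'k\<close> is an explicit
  function \<open>smul\<close>, and subspaces and dimensions are taken with respect to it. By the
  Gelfand-Mazur theorem a type of class \<open>real_normed_field\<close> is isometrically isomorphic to the
  real or to the complex numbers, so the sort constraint \<open>heine_borel\<close> excludes nothing.
\<close>

locale banach_scaling = vector_space smul
  for smul :: "'k::{real_normed_field, heine_borel} \<Rightarrow> 'a::banach \<Rightarrow> 'a" +
  assumes norm_smul: "norm (smul c x) = norm c * norm x"
    and smul_of_real: "smul (of_real r) x = r *\<^sub>R x"

lemma banach_scaling_scaleR: "banach_scaling (scaleR :: real \<Rightarrow> 'a::banach \<Rightarrow> 'a)"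
  by unfold_locales (auto simp: algebra_simps)

lemma banach_scaling_complex: "banach_scaling ((*) :: complex \<Rightarrow> complex \<Rightarrow> complex)"
  by unfold_locales (auto simp: algebra_simps norm_mult scaleR_conv_of_real)

definition closed_subspace ::
  "('k::{real_normed_field, heine_borel} \<Rightarrow> 'a::banach \<Rightarrow> 'a) \<Rightarrow> 'a set \<Rightarrow> bool" where
  "closed_subspace smul S \<longleftrightarrow> module.subspace smul S \<and> closed S"

text \<open>The library's \<open>dim\<close> is a natural number, without meaning for infinite-dimensional
  subspaces.\<close>

definition edim ::
  "('k::{real_normed_field, heine_borel} \<Rightarrow> 'a::banach \<Rightarrow> 'a) \<Rightarrow> 'a set \<Rightarrow> enat" where
  "edim smul S =
     (if \<exists>B. finite B \<and> S \<subseteq> module.span smul B then enat (vector_space.dim smul S) else \<infinity>)"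

definition along :: "nat set \<Rightarrow> nat filter" where
  "along I = inf sequentially (principal I)"

definition lower_uniformly_adjusted ::
  "nat set \<Rightarrow> (nat \<Rightarrow> 'a::banach set) \<Rightarrow> (nat \<Rightarrow> 'a set) \<Rightarrow> real \<Rightarrow> bool" where
  "lower_uniformly_adjusted I M P l \<longleftrightarrow>
     (\<forall>\<eta>>0. \<forall>I'\<subseteq>I. infinite I' \<longrightarrow>
       (\<forall>x. (\<forall>n\<in>I'. x n \<in> M n \<and> norm (x n) = 1) \<longrightarrow>
         (\<exists>I''\<subseteq>I'. infinite I'' \<and>
           (\<exists>y z. (\<forall>n\<in>I''. y n \<in> P n) \<and>
             Limsup (along I'') (\<lambda>n. ereal (norm (x n - y n - z))) \<le> ereal (l + \<eta>)))))"

text \<open>The sets of which the following three infima are taken contain \<open>1\<close> when the subspaces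
  \<open>M n\<close>, for \<open>n \<in> I\<close>, are nonzero, and are bounded below by \<open>0\<close>.\<close>

definition unif_adj ::
  "nat set \<Rightarrow> (nat \<Rightarrow> 'a::banach set) \<Rightarrow> (nat \<Rightarrow> 'a set) \<Rightarrow> real" where
  "unif_adj I M P = Inf {l. l \<ge> 0 \<and> lower_uniformly_adjusted I M P l}"

definition ss_unif_adj ::
  "('k::{real_normed_field, heine_borel} \<Rightarrow> 'a::banach \<Rightarrow> 'a) \<Rightarrow>
    nat set \<Rightarrow> (nat \<Rightarrow> 'a set) \<Rightarrow> (nat \<Rightarrow> 'a set) \<Rightarrow> real" where
  "ss_unif_adj smul I M P = Inf {l. l \<ge> 0 \<and>
     (\<forall>I'\<subseteq>I. infinite I' \<longrightarrow>
       (\<forall>K. (\<forall>n\<in>I'. closed_subspace smul (K n) \<and> K n \<subseteq> M n \<and> edim smul (K n) = \<infinity>) \<longrightarrow>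
         (\<exists>I''\<subseteq>I'. infinite I'' \<and>
           (\<exists>L. (\<forall>n\<in>I''. closed_subspace smul (L n) \<and> L n \<subseteq> K n \<and> edim smul (L n) = \<infinity>) \<and>
             unif_adj I'' L P \<le> l))))}"

definition fss_unif_adj ::
  "('k::{real_normed_field, heine_borel} \<Rightarrow> 'a::banach \<Rightarrow> 'a) \<Rightarrow>
    nat set \<Rightarrow> (nat \<Rightarrow> 'a set) \<Rightarrow> (nat \<Rightarrow> 'a set) \<Rightarrow> real" where
  "fss_unif_adj smul I M P = Inf {l. l \<ge> 0 \<and>
     (\<forall>I'\<subseteq>I. infinite I' \<longrightarrow>
       (\<forall>K. (\<forall>n\<in>I'. module.subspace smul (K n) \<and> K n \<subseteq> M n \<and> edim smul (K n) < \<infinity>) \<and>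
            ((\<lambda>n. edim smul (K n)) \<longlongrightarrow> \<infinity>) (along I') \<longrightarrow>
         (\<exists>I''\<subseteq>I'. infinite I'' \<and>
           (\<exists>L. (\<forall>n\<in>I''. module.subspace smul (L n) \<and> L n \<noteq> {0} \<and> L n \<subseteq> K n) \<and>
             ((\<lambda>n. edim smul (L n)) \<longlongrightarrow> \<infinity>) (along I'') \<and>
             unif_adj I'' L P \<le> l))))}"

definition lower_defect ::
  "('k::{real_normed_field, heine_borel} \<Rightarrow> 'a::banach \<Rightarrow> 'a) \<Rightarrow> 'a set \<Rightarrow> 'a set \<Rightarrow> enat" where
  "lower_defect smul M N = edim smul (M \<inter> N)"

definition lower_semi_fredholm ::
  "('k::{real_normed_field, heine_borel} \<Rightarrow> 'a::banach \<Rightarrow> 'a) \<Rightarrow> 'a set \<Rightarrow> 'a set \<Rightarrow> bool" where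
  "lower_semi_fredholm smul M N \<longleftrightarrow>
     closed_subspace smul M \<and> closed_subspace smul N \<and>
     closed (M + N) \<and> lower_defect smul M N < \<infinity>"

definition sum_map :: "'a::banach \<times> 'a \<times> 'a \<Rightarrow> 'a" where
  "sum_map = (\<lambda>(u, t, v). u + t + v)"

definition max_norm :: "'a::banach \<times> 'a \<times> 'a \<Rightarrow> real" where
  "max_norm = (\<lambda>(u, t, v). max (norm u) (max (norm t) (norm v)))"

text \<open>The operator norm of the inverse of \<open>sum_map\<close>, restricted to the indicated product, as a
  supremum of quotients as in the library's \<open>onorm\<close>; the quotient at \<open>w = 0\<close> is \<open>0\<close>. By the open
  mapping theorem the supremum is finite whenever \<open>M + N\<close> is closed and
  \<open>M + N = (M \<inter> N) \<oplus> S\<close> with closed \<open>S\<close>.\<close>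

definition phi_compl :: "'a::banach set \<Rightarrow> 'a set \<Rightarrow> 'a set \<Rightarrow> real" where
  "phi_compl S M N =
     (SUP w\<in>M + N. max_norm (inv_into ((M \<inter> S) \<times> (M \<inter> N) \<times> (N \<inter> S)) sum_map w) / norm w)"

text \<open>For a lower semi-Fredholm pair the set of admissible \<open>S\<close> is nonempty, because the
  finite-dimensional space \<open>M \<inter> N\<close> is complemented in \<open>M + N\<close>.\<close>

definition phi ::
  "('k::{real_normed_field, heine_borel} \<Rightarrow> 'a::banach \<Rightarrow> 'a) \<Rightarrow> 'a set \<Rightarrow> 'a set \<Rightarrow> real" where
  "phi smul M N =
     Inf {phi_compl S M N | S. closed_subspace smul S \<and>
            M + N = (M \<inter> N) + S \<and> (M \<inter> N) \<inter> S = {0}}"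

end

theory Submission
  imports Defs
begin

text \<open>
  If infinitely many pairs fail, then for these \<open>n\<close> there are closed linear relations
  \<open>G n \<subseteq> Mn n \<times> Nn n\<close> with large domain whose elements \<open>(x, y)\<close> satisfy \<open>norm (x - y) \<le> \<epsilon> n * norm x\<close>,
  \<open>\<epsilon> n \<longlonglongrightarrow> 0\<close>: the identity on \<open>Mn n \<inter> Nn n\<close> or, if \<open>Mn n + Nn n\<close> is not closed, the closure of a
  relation built from unit vectors \<open>x\<^sub>k\<close> ever closer to \<open>Nn n\<close>, each in the kernels of functionals norming
  the previous ones. Adjusting first in the domains and then in the images gives subspaces \<open>L n\<close> with
  dimensions tending to infinity that are adjusted with both \<open>M\<close> and \<open>N\<close>. In every sequence of unit vectors
  \<open>x n \<in> L n\<close> the adjusting vector \<open>z\<close> cancels in differences \<open>x n - x m\<close>, which therefore come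
  within about \<open>\<omega>\<close> of the finite-dimensional space \<open>M \<inter> N\<close>. As \<open>\<omega> < 1 / 2\<close>, a pigeonhole argument with Riesz
  vectors produces a sequence for which they do not.
\<close>

section \<open>Norming functionals\<close>

text \<open>The obstacle is a sum that is not closed: it yields no common vectors of
  \<open>Mn n\<close> and \<open>Nn n\<close>, only nearly common ones, so no single subspace can be
  tested against both adjustments. The relation \<open>G n\<close> carries a subspace of one side to
  a nearby subspace of the other; being injective in both directions, it lets a subspace selected
  inside an image be pulled back without loss of dimension. The constants of \<omega> arise as
  follows. Cancelling z doubles both adjustment constants a and b, so a difference is 2a-close to
  \<open>M\<close> and 2b-close to \<open>N\<close>. The two approximants differ by at most 2(a +
  b), and splitting this difference inside \<open>M + N\<close> moves either of them into
  \<open>M \<inter> N\<close> at a cost of about \<open>phi\<close> times that; the better of the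
  two choices gives the minimum. The bound 1/2 comes from the pigeonhole: two points c-close to the
  same centre are less than 2c apart, while Riesz vectors can be kept at any mutual distance below
  1.\<close>

definition sublinear :: "('a::real_vector \<Rightarrow> real) \<Rightarrow> bool" where
  "sublinear p \<longleftrightarrow> (\<forall>x y. p (x + y) \<le> p x + p y) \<and> (\<forall>t x. 0 \<le> t \<longrightarrow> p (t *\<^sub>R x) = t * p x)"

lemma sublinear_add: "sublinear p \<Longrightarrow> p (x + y) \<le> p x + p y"
  and sublinear_scale: "sublinear p \<Longrightarrow> 0 \<le> t \<Longrightarrow> p (t *\<^sub>R x) = t * p x"
  by (auto simp: sublinear_def)

lemma sublinear_zero: "sublinear p \<Longrightarrow> p 0 = 0"
  using sublinear_scale[of p 0 0] by simp

lemma sublinear_minus: "sublinear p \<Longrightarrow> - p (- x) \<le> p x"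
  using sublinear_add[of p x "- x"] by (simp add: sublinear_zero)

text \<open>The infimum over t \<ge> 0 of p (x + t y) - t p y is again sublinear, because the
  parameters add under sums and scale under multiples. The term t = 1 at x = - y gives the required
  value.\<close>

lemma sublinear_reduce:
  assumes p: "sublinear p"
  obtains q where "sublinear q" "q \<le> p" "q (- y) \<le> - p y"
proof
  define g where "g x t = p (x + t *\<^sub>R y) - t * p y" for x and t :: real
  define q where "q x = (INF t\<in>{0..}. g x t)" for x
  have lb: "- p (- x) \<le> g x t" if "t \<ge> 0" for x t
  proof -
    have "p (t *\<^sub>R y) \<le> p (x + t *\<^sub>R y) + p (- x)"
      using sublinear_add[OF p, of "x + t *\<^sub>R y" "- x"] by simp
    then show ?thesis using that by (simp add: g_def sublinear_scale[OF p])
  qed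
  have bdd: "bdd_below (g x ` {0..})" for x
    using lb by (intro bdd_belowI2[where m = "- p (- x)"]) auto
  have upper: "q x \<le> g x t" if "t \<ge> 0" for x t
    unfolding q_def using that by (intro cINF_lower bdd) auto
  have greatest: "c \<le> q x" if "\<And>t. t \<ge> 0 \<Longrightarrow> c \<le> g x t" for c x
    unfolding q_def using that by (intro cINF_greatest) auto
  have q0: "q 0 = 0"
    using upper[of 0 0] greatest[of 0 0]
    by (force simp: g_def sublinear_scale[OF p] sublinear_zero[OF p])
  have add: "q (x + x') \<le> q x + q x'" for x x'
  proof -
    have "q (x + x') - g x t \<le> g x' t'" if "t \<ge> 0" "t' \<ge> 0" for t t'
    proof -
      have "q (x + x') \<le> g (x + x') (t + t')" using upper that by simp
      moreover have "p ((x + t *\<^sub>R y) + (x' + t' *\<^sub>R y)) \<le> p (x + t *\<^sub>R y) + p (x' + t' *\<^sub>R y)"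
        by (rule sublinear_add[OF p])
      ultimately show ?thesis by (simp add: g_def algebra_simps)
    qed
    then have "q (x + x') - q x' \<le> g x t" if "t \<ge> 0" for t
      using greatest[of "q (x + x') - g x t" x'] that by fastforce
    then show ?thesis using greatest[of "q (x + x') - q x'" x] by fastforce
  qed
  have scale_le: "q (s *\<^sub>R x) \<le> s * q x" if "s > 0" for s x
  proof -
    have "q (s *\<^sub>R x) / s \<le> g x t" if "t \<ge> 0" for t
    proof -
      have "q (s *\<^sub>R x) \<le> g (s *\<^sub>R x) (s * t)" using upper that \<open>s > 0\<close> by simp
      also have "\<dots> = p (s *\<^sub>R (x + t *\<^sub>R y)) - s * t * p y"
        by (simp add: g_def scaleR_add_right)
      also have "\<dots> = s * g x t"
        using \<open>s > 0\<close> by (simp only: sublinear_scale[OF p] less_imp_le) (simp add: g_def algebra_simps)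
      finally show ?thesis using \<open>s > 0\<close> by (simp add: field_simps)
    qed
    then have "q (s *\<^sub>R x) / s \<le> q x" by (rule greatest)
    then show ?thesis using that by (simp add: field_simps)
  qed
  have "q (s *\<^sub>R x) = s * q x" if "s \<ge> 0" for s x
  proof (cases "s = 0")
    case False
    then have "s > 0" using that by simp
    then have "q ((1 / s) *\<^sub>R (s *\<^sub>R x)) \<le> (1 / s) * q (s *\<^sub>R x)" by (intro scale_le) simp
    then have "s * q x \<le> q (s *\<^sub>R x)" using \<open>s > 0\<close> by (simp add: field_simps)
    then show ?thesis using scale_le[OF \<open>s > 0\<close>, of x] by simp
  qed (simp add: q0)
  with add show "sublinear q" by (auto simp: sublinear_def)
  show "q \<le> p"
    using upper[of 0] by (auto simp: le_fun_def g_def)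
  show "q (- y) \<le> - p y"
    using upper[of 1 "- y"] by (simp add: g_def sublinear_zero[OF p])
qed

text \<open>Zorn's lemma for the reversed pointwise order. The infimum of a chain is finite because
  its members lie above - p (- x), and subadditive because two members can be replaced by the
  smaller one.\<close>

lemma minimal_sublinear_exists:
  assumes p: "sublinear p"
  obtains q where "sublinear q" "q \<le> p" "\<And>r. sublinear r \<Longrightarrow> r \<le> q \<Longrightarrow> r = q"
proof -
  define A where "A = {q. sublinear q \<and> q \<le> p}"
  have po: "partial_order_on A (relation_of (\<ge>) A)"
    unfolding partial_order_on_def preorder_on_def refl_on_def trans_def antisym_def relation_of_def
    by auto
  have "\<exists>u\<in>A. \<forall>a\<in>C. u \<le> a" if C: "C \<in> Chains (relation_of (\<ge>) A)" for C
  proof (cases "C = {}")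
    case True
    then show ?thesis using p by (auto simp: A_def)
  next
    case False
    have CA: "sublinear a" "a \<le> p" if "a \<in> C" for a
      using C that by (auto simp: Chains_def relation_of_def A_def)
    have chain: "a \<le> b \<or> b \<le> a" if "a \<in> C" "b \<in> C" for a b
      using C that by (auto simp: Chains_def relation_of_def)
    define u where "u x = (INF a\<in>C. a x)" for x
    have bdd: "bdd_below ((\<lambda>a. a x) ` C)" for x
    proof (rule bdd_belowI2)
      fix a assume "a \<in> C"
      then show "- p (- x) \<le> a x"
        using sublinear_minus[of a x] CA[of a] le_funD[of a p "- x"] by fastforce
    qed
    have lower: "u x \<le> a x" if "a \<in> C" for a x
      unfolding u_def by (rule cINF_lower[OF bdd that])
    have greatest: "c \<le> u x" if "\<And>a. a \<in> C \<Longrightarrow> c \<le> a x" for c x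
      unfolding u_def by (rule cINF_greatest[OF False that])
    have add: "u (x + y) \<le> u x + u y" for x y
    proof -
      have *: "u (x + y) \<le> a x + b y" if ab: "a \<in> C" "b \<in> C" for a b
      proof -
        obtain c where c: "c \<in> C" "c \<le> a" "c \<le> b"
          using chain[OF ab] ab by blast
        have "u (x + y) \<le> c (x + y)" by (rule lower[OF c(1)])
        also have "\<dots> \<le> c x + c y" by (rule sublinear_add[OF CA(1)[OF c(1)]])
        also have "\<dots> \<le> a x + b y" using c by (simp add: add_mono le_funD)
        finally show ?thesis .
      qed
      have "u (x + y) - b y \<le> u x" if "b \<in> C" for b
        using greatest[of "u (x + y) - b y" x] * that by fastforce
      then show ?thesis
        using greatest[of "u (x + y) - u x" y] by fastforce
    qed
    have scale: "u (t *\<^sub>R x) = t * u x" if "t \<ge> 0" for t x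
    proof (cases "t = 0")
      case True
      have "u 0 = (INF a\<in>C. 0)"
        unfolding u_def using CA by (intro INF_cong) (auto simp: sublinear_zero)
      then show ?thesis using True False by simp
    next
      case pos: False
      have "t * u x \<le> u (t *\<^sub>R x)"
        using lower pos that
        by (intro greatest) (simp add: sublinear_scale[OF CA(1)] mult_left_mono)
      moreover have "u (t *\<^sub>R x) / t \<le> u x"
      proof (rule greatest)
        fix a assume "a \<in> C"
        then show "u (t *\<^sub>R x) / t \<le> a x"
          using lower[of a "t *\<^sub>R x"] pos that by (simp add: sublinear_scale[OF CA(1)] field_simps)
      qed
      ultimately show ?thesis using pos that by (simp add: field_simps)
    qed
    obtain a where "a \<in> C" using False by blast
    then have "u \<le> p" using lower CA(2) unfolding le_fun_def by (metis order_trans)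
    with add scale have "u \<in> A" by (auto simp: A_def sublinear_def)
    then show ?thesis using lower by (auto simp: le_fun_def)
  qed
  from predicate_Zorn[OF po this] obtain q where "q \<in> A" "\<forall>a\<in>A. a \<le> q \<longrightarrow> a = q"
    by blast
  then show ?thesis using that[of q] order_trans unfolding A_def by blast
qed

text \<open>A minimal sublinear functional is linear, since \<open>sublinear_reduce\<close> cannot decrease it.\<close>

lemma linear_le_sublinear_exists:
  assumes "sublinear p"
  obtains f where "linear f" "f \<le> p"
proof -
  obtain q where q: "sublinear q" "q \<le> p" and min: "\<And>r. sublinear r \<Longrightarrow> r \<le> q \<Longrightarrow> r = q"
    using minimal_sublinear_exists[OF assms] by blast
  have neg_le: "q (- y) \<le> - q y" for y
    using sublinear_reduce[OF q(1), of y] min by metis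
  have odd: "q (- y) = - q y" for y
    using sublinear_minus[OF q(1), of y] neg_le[of y] by simp
  have "linear q"
  proof
    fix x y and t :: real
    have "- q (x + y) \<le> - q x + - q y"
      using sublinear_add[OF q(1), of "- x" "- y"] odd by (metis minus_add_distrib)
    then show "q (x + y) = q x + q y"
      using sublinear_add[OF q(1), of x y] by simp
    show "q (t *\<^sub>R x) = t *\<^sub>R q x"
    proof (cases "t \<ge> 0")
      case False
      then have "q (- (t *\<^sub>R x)) = - (t * q x)"
        using sublinear_scale[OF q(1), of "- t" x] by simp
      then show ?thesis by (simp add: odd)
    qed (simp add: sublinear_scale[OF q(1)])
  qed
  then show ?thesis using that q(2) by blast
qed

text \<open>Lowering the norm in the direction z before passing to a linear minorant f gives f (- z)
  \<le> - norm z; this replaces the extension of a functional from the line through z.\<close>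

lemma norming_functional_exists:
  fixes z :: "'a::real_normed_vector"
  obtains f :: "'a \<Rightarrow> real" where "linear f" "\<And>x. \<bar>f x\<bar> \<le> norm x" "f z = norm z"
proof -
  have "sublinear (norm :: 'a \<Rightarrow> real)"
    by (simp add: sublinear_def norm_triangle_ineq)
  then obtain q :: "'a \<Rightarrow> real" where q: "sublinear q" "q \<le> norm" "q (- z) \<le> - norm z"
    using sublinear_reduce[of norm z] by blast
  obtain f where f: "linear f" "f \<le> q"
    using linear_le_sublinear_exists[OF q(1)] by blast
  have le: "f x \<le> norm x" for x
    using f(2) q(2) by (meson le_funD order_trans)
  have "\<bar>f x\<bar> \<le> norm x" for x
    using le[of x] le[of "- x"] by (simp add: linear_neg[OF f(1)])
  moreover have "f z = norm z"
    using le[of z] le_funD[OF f(2), of "- z"] q(3) by (simp add: linear_neg[OF f(1)])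
  ultimately show ?thesis using that f(1) by blast
qed

section \<open>Open mappings onto closed images\<close>

text \<open>The open mapping theorem relative to closed subspaces. Baire's theorem is applied in the
  image of D, which is complete: the closed image of some ball has interior there, and iterated
  approximate preimages sum to an exact one.\<close>

lemma bounded_linear_open_onto_closed_image:
  fixes T :: "'b::banach \<Rightarrow> 'c::banach"
  assumes T: "bounded_linear T" and D: "subspace D" "closed D" and Y: "closed (T ` D)"
  obtains C where "\<And>w. w \<in> T ` D \<Longrightarrow> \<exists>d\<in>D. T d = w \<and> norm d \<le> C * norm w"
proof -
  interpret T: bounded_linear T by (rule T)
  have subY: "subspace (T ` D)"
    by (rule linear_subspace_image[OF T.linear_axioms D(1)])
  define F where "F n = closure (T ` (D \<inter> cball 0 (real n)))" for n :: nat
  have FY: "F n \<subseteq> T ` D" for n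
    unfolding F_def using Y by (intro closure_minimal) auto
  have cover: "\<Union>(range F) = T ` D"
  proof
    show "T ` D \<subseteq> \<Union>(range F)"
    proof
      fix w assume "w \<in> T ` D"
      then obtain d where d: "d \<in> D" "w = T d" by auto
      obtain n :: nat where "norm d \<le> real n" using real_arch_simple by blast
      then have "w \<in> F n" unfolding F_def using d by (intro subsetD[OF closure_subset]) auto
      then show "w \<in> \<Union>(range F)" by blast
    qed
  qed (use FY in blast)
  have "\<exists>n. top_of_set (T ` D) interior_of F n \<noteq> {}"
  proof (rule ccontr)
    assume "\<not> ?thesis"
    then have empty: "top_of_set (T ` D) interior_of F n = {}" for n by blast
    have "completely_metrizable_space (top_of_set (T ` D))"
      using completely_metrizable_space_closedin[OF completely_metrizable_space_euclidean, of "T ` D"] Y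
      by simp
    then have "top_of_set (T ` D) interior_of \<Union>(range F) = {}"
      using FY empty
      by (intro Baire_category_alt) (auto simp: F_def intro!: closed_subset)
    then have "T ` D = {}"
      unfolding cover by (metis interior_of_topspace topspace_euclidean_subtopology)
    then show False using subspace_0[OF D(1)] by blast
  qed
  then obtain n y0 U where "openin (top_of_set (T ` D)) U" "y0 \<in> U" "U \<subseteq> F n"
    unfolding interior_of_def by blast
  then obtain r where r: "r > 0" "ball y0 r \<inter> T ` D \<subseteq> F n" and y0: "y0 \<in> T ` D" "y0 \<in> F n"
    unfolding openin_contains_ball by blast
  \<comment> \<open>Approximating both \<open>y0 + w\<close> and \<open>y0\<close> and subtracting
    removes the unknown centre \<open>y0\<close>; hence twice the radius n.\<close>
  have small: "\<exists>d\<in>D. norm d \<le> 2 * real n \<and> norm (w - T d) < e"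
    if w: "w \<in> T ` D" "norm w < r" and e: "e > 0" for w e
  proof -
    have "y0 + w \<in> F n"
      using r(2) w y0 subspace_add[OF subY] by (auto simp: dist_norm)
    then obtain a where a: "a \<in> D" "norm a \<le> real n" "dist (T a) (y0 + w) < e / 2"
      using e unfolding F_def closure_approachable by (auto dest!: spec[of _ "e / 2"])
    obtain b where b: "b \<in> D" "norm b \<le> real n" "dist (T b) y0 < e / 2"
      using y0(2) e unfolding F_def closure_approachable by (auto dest!: spec[of _ "e / 2"])
    have "norm (w - T (a - b)) = norm ((T b - y0) - (T a - (y0 + w)))"
      by (simp add: T.diff algebra_simps)
    also have "\<dots> < e"
      using norm_triangle_ineq4[of "T b - y0" "T a - (y0 + w)"] a(3) b(3) by (simp add: dist_norm)
    finally show ?thesis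
      using a b norm_triangle_ineq4[of a b] by (intro bexI[of _ "a - b"]) (auto intro: subspace_diff[OF D(1)])
  qed
  \<comment> \<open>Rescaling w to norm r / 2 costs a factor 2 norm w / r in the bound 2 n, and
    turns the tolerance r / 4 into norm w / 2.\<close>
  define C where "C = 4 * real n / r"
  have C0: "C \<ge> 0" using r(1) by (simp add: C_def)
  have half: "\<exists>d\<in>D. norm d \<le> C * norm w \<and> norm (w - T d) \<le> norm w / 2" if w: "w \<in> T ` D" for w
  proof (cases "w = 0")
    case True
    then show ?thesis using subspace_0[OF D(1)] by (intro bexI[of _ 0]) (auto simp: T.zero)
  next
    case False
    define s where "s = r / (2 * norm w)"
    have s: "s > 0" using False r(1) by (simp add: s_def)
    have "norm (s *\<^sub>R w) < r" using False r(1) by (simp add: s_def)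
    then obtain d where d: "d \<in> D" "norm d \<le> 2 * real n" "norm (s *\<^sub>R w - T d) < r / 4"
      using small[of "s *\<^sub>R w" "r / 4"] subspace_scale[OF subY w] r(1) by auto
    have "w - T (d /\<^sub>R s) = (s *\<^sub>R w - T d) /\<^sub>R s"
      using s by (simp add: T.scaleR scaleR_diff_right)
    then have "norm (w - T (d /\<^sub>R s)) = norm (s *\<^sub>R w - T d) / s" using s by (simp add: divide_inverse)
    also have "\<dots> \<le> (r / 4) / s" using d(3) s by (intro divide_right_mono) auto
    also have "\<dots> = norm w / 2" using False r(1) by (simp add: s_def)
    finally have 1: "norm (w - T (d /\<^sub>R s)) \<le> norm w / 2" .
    have "norm (d /\<^sub>R s) = norm d / s" using s by (simp add: divide_inverse)
    also have "\<dots> \<le> 2 * real n / s" using d(2) s by (intro divide_right_mono) auto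
    also have "\<dots> = C * norm w" using False r(1) by (simp add: s_def C_def)
    finally show ?thesis using 1 subspace_scale[OF D(1) d(1)] by blast
  qed
  then obtain g where g: "\<And>w. w \<in> T ` D \<Longrightarrow> g w \<in> D \<and> norm (g w) \<le> C * norm w \<and> norm (w - T (g w)) \<le> norm w / 2"
    by metis
  have "\<exists>d\<in>D. T d = w \<and> norm d \<le> 2 * C * norm w" if w: "w \<in> T ` D" for w
  proof -
    \<comment> \<open>\<open>v k\<close> is the residual after k corrections. It halves at each
      step, so the corrections \<open>g (v k)\<close> are summable and their images telescope to
      w.\<close>
    define v where "v k = ((\<lambda>u. u - T (g u)) ^^ k) w" for k
    have v_Suc: "v (Suc k) = v k - T (g (v k))" for k by (simp add: v_def)
    have vY: "v k \<in> T ` D" for k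
    proof (induction k)
      case (Suc k)
      then show ?case unfolding v_Suc using g by (intro subspace_diff[OF subY]) auto
    qed (simp add: v_def w)
    have vn: "norm (v k) \<le> norm w * (1 / 2) ^ k" for k
    proof (induction k)
      case (Suc k)
      then show ?case using g[OF vY[of k]] by (simp add: v_Suc)
    qed (simp add: v_def)
    have gn: "norm (g (v k)) \<le> C * norm w * (1 / 2) ^ k" for k
      using g[OF vY[of k]] mult_left_mono[OF vn[of k] C0] by (simp add: mult.assoc)
    have geo: "(\<lambda>k. C * norm w * (1 / 2) ^ k) sums (C * norm w * 2)"
      using geometric_sums[of "1 / 2 :: real"] by (intro sums_mult) simp
    have sn: "summable (\<lambda>k. norm (g (v k)))"
      using gn by (intro summable_comparison_test'[OF sums_summable[OF geo], of 0]) simp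
    then have sm: "summable (\<lambda>k. g (v k))" by (rule summable_norm_cancel)
    have part: "T (\<Sum>i<k. g (v i)) = w - v k" for k
      by (induction k) (simp_all add: T.zero T.add v_Suc, simp add: v_def)
    have lim: "(\<lambda>k. \<Sum>i<k. g (v i)) \<longlonglongrightarrow> suminf (\<lambda>k. g (v k))"
      using sm by (rule summable_LIMSEQ)
    have "(\<lambda>k. T (\<Sum>i<k. g (v i))) \<longlonglongrightarrow> T (suminf (\<lambda>k. g (v k)))"
      by (rule T.tendsto[OF lim])
    moreover have "v \<longlonglongrightarrow> 0"
    proof (rule Lim_null_comparison)
      show "(\<lambda>k. norm w * (1 / 2) ^ k) \<longlonglongrightarrow> 0"
        by (intro tendsto_mult_right_zero LIMSEQ_realpow_zero) auto
    qed (use vn in simp)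
    then have "(\<lambda>k. w - v k) \<longlonglongrightarrow> w" using tendsto_diff[of "\<lambda>_. w" w _ v 0] by simp
    ultimately have "T (suminf (\<lambda>k. g (v k))) = w"
      unfolding part by (rule LIMSEQ_unique)
    moreover have "suminf (\<lambda>k. g (v k)) \<in> D"
      using g vY by (intro closed_sequentially[OF D(2) _ lim] subspace_sum[OF D(1)]) blast
    moreover have "norm (suminf (\<lambda>k. g (v k))) \<le> 2 * C * norm w"
      using summable_norm[OF sn] suminf_le[OF gn sn sums_summable[OF geo]] sums_unique[OF geo] by simp
    ultimately show ?thesis by blast
  qed
  then show ?thesis using that by blast
qed

section \<open>Finite-dimensional subspaces\<close>

lemma closed_if_bounded_convergent_subsequence:
  fixes S :: "'b::metric_space set"
  assumes "\<And>w. range w \<subseteq> S \<Longrightarrow> bounded (range w) \<Longrightarrow>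
    \<exists>l\<in>S. \<exists>r. strict_mono (r :: nat \<Rightarrow> nat) \<and> (w \<circ> r) \<longlonglongrightarrow> l"
  shows "closed S"
  unfolding closed_sequential_limits
proof (intro allI impI, elim conjE)
  fix u l assume u: "\<forall>n. u n \<in> S" "u \<longlonglongrightarrow> l"
  then obtain l' r where "l' \<in> S" "strict_mono r" "(u \<circ> r) \<longlonglongrightarrow> l'"
    using assms[of u] convergent_imp_bounded[OF u(2)] by blast
  then show "l \<in> S" using LIMSEQ_subseq_LIMSEQ[OF u(2)] LIMSEQ_unique by blast
qed

context banach_scaling
begin

lemma bounded_bilinear_smul: "bounded_bilinear smul"
proof
  fix a a' :: 'k and b b' :: 'a and r :: real
  show "smul (a + a') b = smul a b + smul a' b" by (rule scale_left_distrib)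
  show "smul a (b + b') = smul a b + smul a b'" by (rule scale_right_distrib)
  show "smul (r *\<^sub>R a) b = r *\<^sub>R smul a b"
    by (metis scaleR_conv_of_real scale_scale smul_of_real)
  show "smul a (r *\<^sub>R b) = r *\<^sub>R smul a b"
    by (metis scale_left_commute smul_of_real)
  show "\<exists>K. \<forall>a b. norm (smul a b) \<le> norm a * norm b * K"
    by (rule exI[of _ 1]) (simp add: norm_smul)
qed

lemmas tendsto_smul = bounded_bilinear.tendsto[OF bounded_bilinear_smul]

lemma real_subspace:
  assumes "subspace S"
  shows "Real_Vector_Spaces.subspace S"
proof (rule real_vector.subspaceI)
  fix r and x assume "x \<in> S"
  then show "r *\<^sub>R x \<in> S"
    using subspace_scale[OF assms, of x "of_real r"] by (simp add: smul_of_real)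
qed (use assms in \<open>auto intro: subspace_0 subspace_add\<close>)

text \<open>The constant is the distance from v to U; factoring out k reduces the estimate to v
  itself.\<close>

lemma norm_add_scale_lower_bound:
  assumes U: "subspace U" "closed U" and v: "v \<notin> U"
  obtains d where "d > 0" "\<And>u k. u \<in> U \<Longrightarrow> d * norm k \<le> norm (u + smul k v)"
proof
  have ne: "U \<noteq> {}" using subspace_0[OF U(1)] by blast
  show "infdist v U > 0"
    using v in_closed_iff_infdist_zero[OF U(2) ne, of v] infdist_nonneg[of v U] by linarith
  show "infdist v U * norm k \<le> norm (u + smul k v)" if u: "u \<in> U" for u k
  proof (cases "k = 0")
    case False
    have "- smul (inverse k) u \<in> U"
      using u by (intro subspace_neg subspace_scale U)
    then have "infdist v U \<le> norm (v + smul (inverse k) u)"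
      using infdist_le[of "- smul (inverse k) u" U v] by (simp add: dist_norm)
    then have "infdist v U * norm k \<le> norm (smul k (v + smul (inverse k) u))"
      by (simp add: norm_smul mult.commute mult_left_mono)
    also have "smul k (v + smul (inverse k) u) = u + smul k v"
      using False by (simp add: scale_right_distrib)
    finally show ?thesis .
  qed simp
qed

text \<open>Boundedness of w bounds the coefficients of v; here the Heine-Borel property of the
  scalar field enters.\<close>

lemma convergent_coefficients:
  fixes w :: "nat \<Rightarrow> 'a" and k :: "nat \<Rightarrow> 'k"
  assumes U: "subspace U" "closed U" and v: "v \<notin> U"
    and w: "\<And>n. w n - smul (k n) v \<in> U" and b: "bounded (range w)"
  obtains l :: 'k and r where "strict_mono (r :: nat \<Rightarrow> nat)" "(k \<circ> r) \<longlonglongrightarrow> l"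
proof -
  obtain d where d: "d > 0" "\<And>u k. u \<in> U \<Longrightarrow> d * norm k \<le> norm (u + smul k v)"
    using norm_add_scale_lower_bound[OF U v] by blast
  obtain c where "\<And>n. norm (w n) \<le> c" using b by (auto simp: bounded_iff)
  moreover have "d * norm (k n) \<le> norm (w n)" for n
    using d(2)[OF w[of n], of "k n"] by simp
  ultimately have "norm (k n) \<le> c / d" for n
    using d(1) by (metis mult.commute order_trans pos_le_divide_eq)
  then have "bounded (range k)" by (auto simp: bounded_iff)
  then show ?thesis using that bounded_imp_convergent_subsequence by blast
qed

lemma closed_add_line:
  assumes U: "subspace U" "closed U"
  shows "closed {x. \<exists>k. x - smul k v \<in> U}"
proof (cases "v \<in> U")
  case True
  have "{x. \<exists>k. x - smul k v \<in> U} = U"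
  proof (intro equalityI subsetI CollectI)
    fix x assume "x \<in> {x. \<exists>k. x - smul k v \<in> U}"
    then obtain k where "x - smul k v \<in> U" by blast
    then have "(x - smul k v) + smul k v \<in> U"
      by (intro subspace_add[OF U(1)] subspace_scale[OF U(1) True])
    then show "x \<in> U" by simp
  qed (auto intro: exI[of _ 0])
  then show ?thesis using U by simp
next
  case False
  show ?thesis unfolding closed_sequential_limits
  proof (intro allI impI, elim conjE)
    fix w l assume w: "\<forall>n. w n \<in> {x. \<exists>k. x - smul k v \<in> U}" and l: "w \<longlonglongrightarrow> l"
    then obtain k where k: "\<And>n. w n - smul (k n) v \<in> U" by (auto simp: choice_iff)
    obtain a r where r: "strict_mono r" "(k \<circ> r) \<longlonglongrightarrow> a"
      by (rule convergent_coefficients[OF U False k convergent_imp_bounded[OF l]])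
    have "(\<lambda>n. (w \<circ> r) n - smul ((k \<circ> r) n) v) \<longlonglongrightarrow> l - smul a v"
      by (intro tendsto_diff tendsto_smul r(2) tendsto_const LIMSEQ_subseq_LIMSEQ[OF l r(1)])
    then have "l - smul a v \<in> U" by (rule closed_sequentially[OF U(2), rotated]) (simp add: k)
    then show "l \<in> {x. \<exists>k. x - smul k v \<in> U}" by blast
  qed
qed

text \<open>Induction on the generators. The induction hypothesis also makes the smaller span
  closed, which keeps a new vector at positive distance from it and so controls its
  coefficient.\<close>

lemma span_bounded_convergent_subsequence:
  assumes "finite B" "range w \<subseteq> span B" "bounded (range w)"
  shows "\<exists>l\<in>span B. \<exists>r. strict_mono (r :: nat \<Rightarrow> nat) \<and> (w \<circ> r) \<longlonglongrightarrow> l"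
  using assms
proof (induction B arbitrary: w rule: finite_induct)
  case empty
  then have "w = (\<lambda>_. 0)" by auto
  then show ?case by (auto intro!: exI[of _ id] simp: strict_mono_id o_def)
next
  case (insert v B)
  have closed: "closed (span B)"
    using insert.IH by (rule closed_if_bounded_convergent_subsequence)
  show ?case
  proof (cases "v \<in> span B")
    case True
    then show ?thesis using insert.IH[of w] insert.prems by (simp add: span_redundant)
  next
    case False
    obtain k where k: "\<And>n. w n - smul (k n) v \<in> span B"
      using insert.prems(1) unfolding span_insert by (auto simp: choice_iff image_subset_iff)
    obtain a r where r: "strict_mono r" "(k \<circ> r) \<longlonglongrightarrow> a"
      by (rule convergent_coefficients[OF subspace_span closed False k insert.prems(2)])
    define u where "u n = w (r n) - smul (k (r n)) v" for n
    have "bounded (range (\<lambda>n. smul (k (r n)) v))"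
      using tendsto_smul[OF r(2) tendsto_const[of v]] by (intro convergent_imp_bounded) (simp add: o_def)
    moreover have "bounded (range (w \<circ> r))"
      by (rule bounded_subset[OF insert.prems(2)]) auto
    ultimately have "bounded (range u)"
      unfolding u_def by (simp add: bounded_minus_comp o_def)
    moreover have "range u \<subseteq> span B" using k by (auto simp: u_def)
    ultimately obtain l s where s: "l \<in> span B" "strict_mono s" "(u \<circ> s) \<longlonglongrightarrow> l"
      using insert.IH by blast
    have "(\<lambda>n. (u \<circ> s) n + smul (((k \<circ> r) \<circ> s) n) v) \<longlonglongrightarrow> l + smul a v"
      by (intro tendsto_add s(3) tendsto_smul LIMSEQ_subseq_LIMSEQ[OF r(2) s(2)] tendsto_const)
    then have "(w \<circ> (r \<circ> s)) \<longlonglongrightarrow> l + smul a v" by (simp add: u_def o_def)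
    moreover have "l + smul a v \<in> span (insert v B)"
      unfolding span_insert using s(1) by (auto intro!: exI[of _ a])
    ultimately show ?thesis using strict_mono_o[OF r(1) s(2)] by blast
  qed
qed

lemma compact_span_Int_cball:
  assumes "finite B"
  shows "compact (span B \<inter> cball 0 R)"
  unfolding compact_def
proof (intro allI impI)
  fix w :: "nat \<Rightarrow> 'a" assume w: "\<forall>n. w n \<in> span B \<inter> cball 0 R"
  then have "range w \<subseteq> span B" "bounded (range w)"
    by (auto simp: bounded_iff)
  then obtain l r where l: "l \<in> span B" "strict_mono r" "(w \<circ> r) \<longlonglongrightarrow> l"
    using span_bounded_convergent_subsequence[OF assms, of w] by blast
  moreover have "l \<in> cball 0 R"
    by (rule closed_sequentially[OF closed_cball _ l(3)]) (use w in simp)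
  ultimately show "\<exists>l\<in>span B \<inter> cball 0 R. \<exists>r. strict_mono r \<and> (w \<circ> r) \<longlonglongrightarrow> l" by blast
qed

lemma closed_span:
  assumes "finite B"
  shows "closed (span B)"
  using span_bounded_convergent_subsequence[OF assms]
  by (rule closed_if_bounded_convergent_subsequence)

section \<open>Dimension as an extended natural number\<close>

lemma not_subset_span_if_less_edim:
  assumes "enat k < edim smul S" "finite B" "card B \<le> k"
  shows "\<not> S \<subseteq> span B"
proof
  assume *: "S \<subseteq> span B"
  then have "edim smul S = enat (dim S)" using assms(2) by (auto simp: edim_def)
  also have "\<dots> \<le> enat k" using dim_le_card[OF * assms(2)] assms(3) by simp
  finally show False using assms(1) by simp
qed

lemma card_le_edim:
  assumes "independent A" "A \<subseteq> S" "finite A"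
  shows "enat (card A) \<le> edim smul S"
proof (cases "\<exists>B. finite B \<and> S \<subseteq> span B")
  case True
  then obtain B where B: "finite B" "S \<subseteq> span B" by blast
  obtain C where C: "C \<subseteq> S" "independent C" "S \<subseteq> span C" "card C = dim S"
    using basis_exists[of S] by blast
  have "finite C" using independent_span_bound[OF B(1) C(2)] B C by blast
  then have "card A \<le> card C" using independent_span_bound[of C A] assms C by blast
  then show ?thesis using True C by (auto simp: edim_def)
qed (auto simp: edim_def)

lemma independent_subset_of_card:
  assumes "enat k \<le> edim smul S"
  obtains A where "A \<subseteq> S" "independent A" "finite A" "card A = k"
proof -
  have "\<exists>A\<subseteq>S. independent A \<and> finite A \<and> card A = k"
    using assms
  proof (induction k)
    case 0
    then show ?case by (intro exI[of _ "{}"]) (auto simp: independent_empty)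
  next
    case (Suc k)
    then have k: "enat k < edim smul S"
      by (metis Suc_ile_eq)
    then obtain A where A: "A \<subseteq> S" "independent A" "finite A" "card A = k"
      using Suc.IH by (auto simp: less_imp_le)
    obtain x where x: "x \<in> S" "x \<notin> span A"
      using not_subset_span_if_less_edim[OF k A(3)] A by blast
    then have "x \<notin> A" using span_base by blast
    then show ?case
      using A x independent_insertI[OF x(2) A(2)] by (intro exI[of _ "insert x A"]) auto
  qed
  then show ?thesis using that by blast
qed

lemma edim_span_independent:
  assumes "independent A" "finite A"
  shows "edim smul (span A) = enat (card A)"
  using assms by (auto simp: edim_def dim_eq_card_independent)

lemma edim_mono:
  assumes "S \<subseteq> T"
  shows "edim smul S \<le> edim smul T"
proof (cases "\<exists>B. finite B \<and> T \<subseteq> span B")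
  case True
  then obtain B where "finite B" "T \<subseteq> span B" by blast
  moreover have "\<exists>B. finite B \<and> S \<subseteq> span B" using True assms by blast
  moreover obtain C where C: "C \<subseteq> S" "independent C" "S \<subseteq> span C" "card C = dim S"
    using basis_exists[of S] by blast
  ultimately show ?thesis
    using card_le_edim[of C T] independent_span_bound[of B C] assms by (auto simp: edim_def)
qed (auto simp: edim_def)

lemma edim_finite_obtain_basis:
  assumes "edim smul S < \<infinity>"
  obtains B where "B \<subseteq> S" "independent B" "S \<subseteq> span B" "finite B" "edim smul S = enat (card B)"
proof -
  obtain C where C: "finite C" "S \<subseteq> span C" using assms by (auto simp: edim_def split: if_splits)
  obtain B where B: "B \<subseteq> S" "independent B" "S \<subseteq> span B" "card B = dim S"
    using basis_exists[of S] by blast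
  have "edim smul S = enat (card B)" using C B by (auto simp: edim_def)
  moreover have "finite B" using independent_span_bound[OF C(1) B(2)] B C by blast
  ultimately show ?thesis using that B by blast
qed

section \<open>Riesz vectors and compactness\<close>

text \<open>Riesz's lemma iterated: normalizing x - v, with v an almost nearest point in the span of
  the earlier vectors, gives a vector at distance more than a from that span.\<close>

lemma separated_unit_vectors:
  assumes L: "subspace L" "enat k \<le> edim smul L" and c: "c < 1"
  obtains E where "E \<subseteq> L" "finite E" "card E = k" "\<And>x. x \<in> E \<Longrightarrow> norm x = 1"
    "\<And>x y. x \<in> E \<Longrightarrow> y \<in> E \<Longrightarrow> x \<noteq> y \<Longrightarrow> c < norm (x - y)"
proof -
  \<comment> \<open>c may be zero or negative; the maximum makes a positive, as the quotient
    \<open>d / a\<close> and the newness of each vector require.\<close>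
  define a where "a = max c (1 / 2)"
  have a: "0 < a" "a < 1" "c \<le> a" using c by (auto simp: a_def)
  have "\<exists>E\<subseteq>L. finite E \<and> card E = k \<and> (\<forall>x\<in>E. norm x = 1) \<and> (\<forall>x\<in>E. \<forall>y\<in>E. x \<noteq> y \<longrightarrow> a < norm (x - y))"
    using L(2)
  proof (induction k)
    case 0
    then show ?case by (intro exI[of _ "{}"]) auto
  next
    case (Suc k)
    then have k: "enat k < edim smul L"
      by (metis Suc_ile_eq)
    then obtain E where E: "E \<subseteq> L" "finite E" "card E = k" "\<forall>x\<in>E. norm x = 1"
        "\<forall>x\<in>E. \<forall>y\<in>E. x \<noteq> y \<longrightarrow> a < norm (x - y)"
      using Suc.IH by (auto simp: less_imp_le)
    obtain x where x: "x \<in> L" "x \<notin> span E"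
      using not_subset_span_if_less_edim[OF k E(2)] E by blast
    have ne: "span E \<noteq> {}" using span_zero by blast
    define d where "d = infdist x (span E)"
    have d: "d > 0"
      using x(2) in_closed_iff_infdist_zero[OF closed_span[OF E(2)] ne, of x]
        infdist_nonneg[of x "span E"] unfolding d_def by (metis order_le_imp_less_or_eq)
    then have "d < d / a" using a by (simp add: field_simps)
    then obtain v where v: "v \<in> span E" "norm (x - v) < d / a"
      using cInf_lessD[of "(\<lambda>y. dist x y) ` span E" "d / a"] ne
      unfolding d_def infdist_notempty[OF ne] by (auto simp: dist_norm)
    have xv: "x - v \<noteq> 0" using v x by auto
    define s where "s = norm (x - v)"
    define e where "e = smul (of_real (1 / s)) (x - v)"
    have s: "s > 0" "s < d / a" using xv v by (auto simp: s_def)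
    have spanE: "span E \<subseteq> L" using E(1) L(1) by (rule span_minimal)
    have far: "a < norm (e - y)" if "y \<in> span E" for y
    proof -
      have "v + smul (of_real s) y \<in> span E" using that v by (intro span_add span_scale)
      then have "d \<le> norm (x - (v + smul (of_real s) y))"
        using infdist_le[of _ "span E" x] by (simp add: d_def dist_norm)
      also have "x - (v + smul (of_real s) y) = smul (of_real s) (e - y)"
        using s(1) by (simp add: e_def scale_right_diff_distrib smul_of_real algebra_simps)
      also have "norm \<dots> = s * norm (e - y)" using s(1) by (simp add: norm_smul)
      finally have "d / s \<le> norm (e - y)" using s(1) by (simp add: field_simps)
      moreover have "a < d / s" using s a by (simp add: field_simps)
      ultimately show ?thesis by linarith
    qed
    have "e \<in> L" unfolding e_def using x v spanE by (intro subspace_scale subspace_diff L) auto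
    moreover have "norm e = 1" using s(1) unfolding e_def norm_smul norm_of_real by (simp flip: s_def)
    moreover have "e \<notin> E" using far[of e] a span_base[of e E] by auto
    ultimately show ?case
      using E far[OF span_base] by (intro exI[of _ "insert e E"]) (auto simp: norm_minus_commute)
  qed
  then show ?thesis using that a(3) by (metis order.strict_trans1)
qed

text \<open>Pigeonhole: since 2 c < 1, one more unit vector than there are centres can be chosen
  with mutual distances above 2 c, yet two of them would share a centre.\<close>

lemma edim_le_card_if_unit_sphere_covered:
  assumes L: "subspace L" and F: "finite F" and c: "c < 1 / 2"
    and cov: "\<And>x. x \<in> L \<Longrightarrow> norm x = 1 \<Longrightarrow> \<exists>q\<in>F. norm (x - q) < c"
  shows "edim smul L \<le> enat (card F)"
proof (rule ccontr)
  assume "\<not> ?thesis"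
  then have "enat (Suc (card F)) \<le> edim smul L" by (simp add: Suc_ile_eq)
  then obtain E where E: "E \<subseteq> L" "finite E" "card E = Suc (card F)" "\<And>x. x \<in> E \<Longrightarrow> norm x = 1"
      "\<And>x y. x \<in> E \<Longrightarrow> y \<in> E \<Longrightarrow> x \<noteq> y \<Longrightarrow> 2 * c < norm (x - y)"
    using separated_unit_vectors[OF L, of "Suc (card F)" "2 * c"] c by auto
  obtain q where q: "\<And>x. x \<in> E \<Longrightarrow> q x \<in> F \<and> norm (x - q x) < c"
    using cov E(1,4) by (metis subsetD)
  have "\<not> inj_on q E"
    using card_inj_on_le[of q E F] q F E(3) by auto
  then obtain x y where xy: "x \<in> E" "y \<in> E" "x \<noteq> y" "q x = q y" by (auto simp: inj_on_def)
  have "norm (x - y) \<le> norm (x - q x) + norm (y - q y)"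
    using norm_triangle_ineq4[of "x - q x" "y - q y"] xy(4) by simp
  then show False using q[OF xy(1)] q[OF xy(2)] E(5)[OF xy(1-3)] by linarith
qed

text \<open>A finite net of radius e replaces C by finitely many centres while c + e stays below 1 /
  2. The bound p is the size of the net, so it is the same for all subspaces L.\<close>

lemma unit_vector_far_from_compact:
  assumes C: "compact C" and c: "c < 1 / 2"
  obtains p where "\<And>L. subspace L \<Longrightarrow> enat p < edim smul L \<Longrightarrow> \<exists>x\<in>L. norm x = 1 \<and> (\<forall>q\<in>C. c \<le> norm (x - q))"
proof -
  define e where "e = (1 / 2 - c) / 2"
  have e: "e > 0" "c + e < 1 / 2" using c by (simp_all add: e_def field_simps)
  obtain F where F: "finite F" "F \<subseteq> C" "C \<subseteq> (\<Union>x\<in>F. ball x e)"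
    using compactE_image[OF C, of C "\<lambda>x. ball x e"] e(1) centre_in_ball open_ball
    by (metis UN_I subsetI)
  show ?thesis
  proof (rule that, rule ccontr)
    fix L assume L: "subspace L" "enat (card F) < edim smul L"
      and "\<not> (\<exists>x\<in>L. norm x = 1 \<and> (\<forall>q\<in>C. c \<le> norm (x - q)))"
    then have *: "\<exists>q\<in>C. norm (x - q) < c" if "x \<in> L" "norm x = 1" for x using that by force
    have "\<exists>q\<in>F. norm (x - q) < c + e" if x: "x \<in> L" "norm x = 1" for x
    proof -
      obtain q where q: "q \<in> C" "norm (x - q) < c" using *[OF x] by blast
      then obtain q' where "q' \<in> F" "dist q' q < e" using F(3) by auto
      then show ?thesis
        using q(2) norm_triangle_ineq[of "x - q" "q - q'"]
        by (intro bexI[of _ q']) (auto simp: dist_norm norm_minus_commute)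
    qed
    then show False
      using edim_le_card_if_unit_sphere_covered[OF L(1) F(1) e(2)] L(2) by (simp add: leD)
  qed
qed

end

section \<open>Complements and the number phi\<close>

context banach_scaling
begin

text \<open>Each line \<open>smul a z\<close> is locally compact, hence of finite dimension over the reals.\<close>

lemma finite_real_basis_of_scalars:
  fixes z :: 'a
  assumes z: "z \<noteq> 0"
  obtains B :: "'k set" where "finite_dimensional_vector_space scaleR B"
proof -
  interpret R: banach_scaling "scaleR :: real \<Rightarrow> 'a \<Rightarrow> 'a" by (rule banach_scaling_scaleR)
  define h where "h a = smul a z" for a
  have h: "bounded_linear h"
    unfolding h_def by (rule bounded_bilinear.bounded_linear_left[OF bounded_bilinear_smul])
  then have lin: "linear h" by (rule bounded_linear.linear)
  have inj: "inj h" using z by (auto simp: h_def inj_def scale_right_imp_eq)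
  \<comment> \<open>This compact set contains all unit vectors of the line, so none of them can be
    far from it.\<close>
  have "compact (h ` cball 0 (1 / norm z))"
    by (intro compact_continuous_image bounded_linear.continuous_on[OF h] continuous_on_id compact_cball)
  then obtain p where p: "\<And>L. module.subspace ((*\<^sub>R) :: real \<Rightarrow> 'a \<Rightarrow> 'a) L \<Longrightarrow> enat p < edim scaleR L \<Longrightarrow>
      \<exists>x\<in>L. norm x = 1 \<and> (\<forall>q\<in>h ` cball 0 (1 / norm z). 1 / 4 \<le> norm (x - q))"
    using R.unit_vector_far_from_compact[of "h ` cball 0 (1 / norm z)" "1 / 4"] by auto
  have "\<not> enat p < edim scaleR (range h)"
  proof
    assume "enat p < edim scaleR (range h)"
    from p[OF linear_subspace_image[OF lin real_vector.subspace_UNIV, unfolded subspace_raw_def] this]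
    obtain a where a: "norm (h a) = 1" "\<forall>q\<in>h ` cball 0 (1 / norm z). 1 / 4 \<le> norm (h a - q)"
      by (elim bexE conjE rangeE) simp
    then have "a \<in> cball 0 (1 / norm z)" using z by (simp add: h_def norm_smul field_simps)
    then show False using bspec[OF a(2), of "h a"] by simp
  qed
  then have "edim scaleR (range h) < \<infinity>"
    by (cases "edim scaleR (range h)") auto
  then obtain B where B: "B \<subseteq> range h" "range h \<subseteq> Real_Vector_Spaces.span B" "finite B"
    unfolding span_raw_def by (rule R.edim_finite_obtain_basis)
  define C where "C = inv h ` B"
  have "h ` C = B" using B(1) by (force simp: C_def image_image f_inv_into_f)
  then have "range h \<subseteq> h ` Real_Vector_Spaces.span C"
    using B(2) linear_span_image[OF lin, of C] by simp
  then have C: "Real_Vector_Spaces.span C = UNIV"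
    using inj by (metis inj_image_subset_iff top.extremum_uniqueI)
  obtain D where D: "D \<subseteq> C" "\<not> Real_Vector_Spaces.dependent D" "C \<subseteq> Real_Vector_Spaces.span D"
    using real_vector.basis_exists[of C] by metis
  have "Real_Vector_Spaces.span D = UNIV"
    using real_vector.span_minimal[OF D(3) real_vector.subspace_span] C by auto
  moreover have "finite D" using D(1) B(3) by (auto simp: C_def intro: finite_subset)
  ultimately have "finite_dimensional_vector_space scaleR D"
    using D(2) unfolding span_raw_def dependent_raw_def by unfold_locales auto
  then show ?thesis by (rule that)
qed

text \<open>The map \<open>a \<mapsto> (c \<mapsto> f (c a z))\<close> from the scalar field to its real dual is injective, hence
  surjective because the scalar field has finite dimension over the reals.\<close>

lemma real_functional_scale_surj:
  fixes f :: "'a \<Rightarrow> real"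
  assumes f: "linear f" and z: "f z \<noteq> 0"
  obtains a where "\<And>c. f (smul c x) = f (smul (c * a) z)"
proof -
  obtain B :: "'k set" where "finite_dimensional_vector_space scaleR B"
    using z finite_real_basis_of_scalars[of z] linear_0[OF f] by blast
  then interpret B: finite_dimensional_vector_space "scaleR :: real \<Rightarrow> 'k \<Rightarrow> 'k" B .
  \<comment> \<open>The real functional c \<mapsto> f (c a z) is encoded by taking its values on the
    basis as coordinates, so that T is a real endomorphism of the scalar field.\<close>
  define T where "T a = (\<Sum>b\<in>B. f (smul (b * a) z) *\<^sub>R b)" for a
  have coeff: "g = h" if gh: "(\<Sum>b\<in>B. g b *\<^sub>R b) = (\<Sum>b\<in>B. h b *\<^sub>R b)"
      and out: "\<And>b. b \<notin> B \<Longrightarrow> g b = h b" for g h :: "'k \<Rightarrow> real"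
  proof
    fix b
    have "(\<Sum>b\<in>B. (g b - h b) *\<^sub>R b) = 0"
      using gh by (simp add: scaleR_diff_left sum_subtractf)
    then show "g b = h b"
      using real_vector.independentD[OF B.independent_Basis[folded dependent_raw_def] B.finite_Basis order_refl, of "\<lambda>b. g b - h b" b] out
      by (cases "b \<in> B") auto
  qed
  have agree: "f (smul c u) = f (smul c v)"
    if eq: "\<And>b. b \<in> B \<Longrightarrow> f (smul b u) = f (smul b v)" for u v c
  proof -
    have "c \<in> Real_Vector_Spaces.span B" using B.span_Basis by (simp add: span_raw_def)
    then show ?thesis
    proof (induction rule: real_vector.span_induct_alt)
      case base
      then show ?case by simp
    next
      case (step t b c)
      have "f (smul (t *\<^sub>R b + c) w) = t * f (smul b w) + f (smul c w)" for w
        by (simp add: scale_left_distrib bounded_bilinear.scaleR_left[OF bounded_bilinear_smul]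
            linear_add[OF f] linear_scale[OF f])
      then show ?case using step eq by simp
    qed
  qed
  have lin: "Vector_Spaces.linear scaleR scaleR T"
    by unfold_locales (simp_all add: T_def ring_distribs scale_left_distrib linear_add[OF f]
        scaleR_add_left sum.distrib bounded_bilinear.scaleR_left[OF bounded_bilinear_smul]
        linear_scale[OF f] scaleR_sum_right)
  have "inj T"
  proof (rule injI)
    fix a a' assume *: "T a = T a'"
    \<comment> \<open>Both functions are set to 0 outside B, because \<open>coeff\<close> compares
      functions on the whole field.\<close>
    have "(\<lambda>b. if b \<in> B then f (smul (b * a) z) else 0) = (\<lambda>b. if b \<in> B then f (smul (b * a') z) else 0)"
      using * by (intro coeff) (simp_all add: T_def)
    then have "f (smul b (smul a z)) = f (smul b (smul a' z))" if "b \<in> B" for b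
      using that by (auto dest!: fun_cong[of _ _ b])
    then have **: "f (smul c (smul a z)) = f (smul c (smul a' z))" for c
      using agree[of "smul a z" "smul a' z" c] by simp
    show "a = a'"
    proof (rule ccontr)
      assume "a \<noteq> a'"
      have "f (smul (inverse (a - a')) (smul (a - a') z)) = 0"
        using **[of "inverse (a - a')"]
        by (simp only: scale_left_diff_distrib scale_right_diff_distrib linear_diff[OF f] scale_scale)
      then show False using \<open>a \<noteq> a'\<close> z by simp
    qed
  qed
  then have "surj T" by (rule B.linear_inj_imp_surj[OF lin])
  then obtain a where a: "T a = (\<Sum>b\<in>B. f (smul b x) *\<^sub>R b)" by (metis surjD)
  have "(\<lambda>b. if b \<in> B then f (smul (b * a) z) else 0) = (\<lambda>b. if b \<in> B then f (smul b x) else 0)"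
    using a by (intro coeff) (simp_all add: T_def)
  then have "f (smul b x) = f (smul b (smul a z))" if "b \<in> B" for b
    using that by (auto dest!: fun_cong[of _ _ b])
  then have "f (smul c x) = f (smul c (smul a z))" for c
    using agree[of x "smul a z" c] by simp
  then show ?thesis using that by simp
qed

text \<open>The largest subspace over the scalar field on which \<open>f\<close> vanishes.\<close>

definition ker :: "('a \<Rightarrow> real) \<Rightarrow> 'a set" where
  "ker f = {x. \<forall>c. f (smul c x) = 0}"

lemma closed_subspace_ker:
  assumes f: "linear f" "\<And>x. \<bar>f x\<bar> \<le> norm x"
  shows "closed_subspace smul (ker f)"
proof -
  have "bounded_linear f"
    using f(1) by (rule bounded_linear.intro) (auto simp: bounded_linear_axioms_def f(2) intro!: exI[of _ 1])
  then have "closed {x. f (smul c x) = 0}" for c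
    by (intro closed_Collect_eq continuous_on_const
        bounded_linear.continuous_on[OF _ bounded_linear.continuous_on
          [OF bounded_bilinear.bounded_linear_right[OF bounded_bilinear_smul] continuous_on_id]])
  then have "closed (ker f)" by (simp add: ker_def closed_Collect_all)
  moreover have "subspace (ker f)"
    by (rule subspaceI) (auto simp: ker_def linear_0[OF f(1)] linear_add[OF f(1)] scale_right_distrib)
  ultimately show ?thesis by (simp add: closed_subspace_def)
qed

lemma ker_zero: "x \<in> ker f \<Longrightarrow> f x = 0"
  unfolding ker_def by (metis (mono_tags, lifting) mem_Collect_eq scale_one)

text \<open>f is only real-linear, so the quotient f x / f z would not do over a larger field: the
  scalar a has to match f on all multiples of x at once.\<close>

lemma ker_decompose:
  assumes f: "linear f" and z: "f z \<noteq> 0"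
  obtains a where "x - smul a z \<in> ker f"
proof -
  obtain a where "\<And>c. f (smul c x) = f (smul (c * a) z)"
    using real_functional_scale_surj[OF f z] by blast
  then have "x - smul a z \<in> ker f"
    by (simp add: ker_def scale_right_diff_distrib linear_diff[OF f])
  then show ?thesis by (rule that)
qed

text \<open>Each new generator z is split as b + s with s in the current complement S, and S is cut
  by the kernel of a functional norming s. Since s itself lies in S, correcting by multiples of s
  does not leave S.\<close>

lemma finite_span_complemented:
  assumes "finite B"
  obtains S where "closed_subspace smul S" "span B \<inter> S = {0}" "\<And>x. \<exists>b\<in>span B. x - b \<in> S"
proof -
  have "\<exists>S. closed_subspace smul S \<and> span B \<inter> S = {0} \<and> (\<forall>x. \<exists>b\<in>span B. x - b \<in> S)"
    using assms
  proof induction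
    case empty
    then show ?case by (intro exI[of _ UNIV]) (auto simp: closed_subspace_def)
  next
    case (insert z B)
    then obtain S where S: "closed_subspace smul S" "span B \<inter> S = {0}" "\<And>x. \<exists>b\<in>span B. x - b \<in> S"
      by blast
    then have subS: "subspace S" by (simp add: closed_subspace_def)
    obtain b where b: "b \<in> span B" "z - b \<in> S" using S(3) by blast
    show ?case
    proof (cases "z - b = 0")
      case True
      then have "span (insert z B) = span B" using b span_redundant by simp
      then show ?thesis using S by auto
    next
      case False
      define s where "s = z - b"
      obtain f :: "'a \<Rightarrow> real" where f: "linear f" "\<And>x. \<bar>f x\<bar> \<le> norm x" "f s = norm s"
        using norming_functional_exists by blast
      have fs: "f s \<noteq> 0" using f(3) False by (simp add: s_def)
      have "closed_subspace smul (S \<inter> ker f)"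
        using S(1) closed_subspace_ker[OF f(1,2)]
        by (auto simp: closed_subspace_def intro: subspace_inter)
      moreover have "span (insert z B) \<inter> (S \<inter> ker f) = {0}"
      proof (intro equalityI subsetI)
        fix x assume x: "x \<in> span (insert z B) \<inter> (S \<inter> ker f)"
        then obtain k where k: "x - smul k z \<in> span B" by (auto simp: span_insert)
        have "x - smul k s = (x - smul k z) + smul k b" by (simp add: s_def scale_right_diff_distrib)
        also have "\<dots> \<in> span B" using k b by (intro span_add span_scale)
        finally have "x - smul k s \<in> span B \<inter> S"
          using x b by (auto simp: s_def intro!: subspace_diff[OF subS] subspace_scale[OF subS])
        then have xk: "x = smul k s" using S(2) by auto
        have "k = 0"
        proof (rule ccontr)
          assume "k \<noteq> 0"
          have "f (smul (inverse k) x) = 0" using x unfolding ker_def by blast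
          then show False using xk \<open>k \<noteq> 0\<close> fs by simp
        qed
        then show "x \<in> {0}" using xk by simp
      qed (use calculation subspace_0[of "S \<inter> ker f"] in \<open>auto simp: span_zero closed_subspace_def\<close>)
      moreover have "\<exists>b'\<in>span (insert z B). x - b' \<in> S \<inter> ker f" for x
      proof -
        obtain b' where b': "b' \<in> span B" "x - b' \<in> S" using S(3) by blast
        obtain a where a: "x - b' - smul a s \<in> ker f" using ker_decompose[OF f(1) fs] by blast
        have "s \<in> span (insert z B)"
          unfolding s_def using b(1) span_mono[of B "insert z B"]
          by (intro span_diff) (auto intro: span_base)
        then have "b' + smul a s \<in> span (insert z B)"
          using b'(1) span_mono[of B "insert z B"] by (intro span_add span_scale) auto
        moreover have "x - b' - smul a s \<in> S"
          using subspace_diff[OF subS b'(2) subspace_scale[OF subS b(2), of a]] by (simp add: s_def)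
        ultimately show ?thesis
          using a by (intro bexI[of _ "b' + smul a s"]) (simp_all add: diff_diff_eq)
      qed
      ultimately show ?thesis by blast
    qed
  qed
  then show ?thesis using that by blast
qed

section \<open>Sums of subspaces and the decomposition constant\<close>

lemma subspace_set_plus:
  assumes "subspace U" "subspace V"
  shows "subspace (U + V)"
proof -
  have "U + V = {x + y | x y. x \<in> U \<and> y \<in> V}" by (auto simp: set_plus_def)
  then show ?thesis using subspace_sums[OF assms] by simp
qed

lemma subset_set_plus:
  assumes "subspace U" "subspace V"
  shows "U \<subseteq> U + V" "V \<subseteq> U + V"
  using set_plus_intro[OF _ subspace_0[OF assms(2)]] set_plus_intro[OF subspace_0[OF assms(1)]] by auto

lemma phi_admissible_nonempty:
  assumes "lower_semi_fredholm smul M N"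
  obtains S where "closed_subspace smul S" "M + N = (M \<inter> N) + S" "(M \<inter> N) \<inter> S = {0}"
proof -
  have M: "subspace M" and N: "subspace N" and cl: "closed (M + N)" and fin: "edim smul (M \<inter> N) < \<infinity>"
    using assms by (auto simp: lower_semi_fredholm_def closed_subspace_def lower_defect_def)
  have MN: "subspace (M \<inter> N)" by (rule subspace_inter[OF M N])
  obtain B where B: "B \<subseteq> M \<inter> N" "M \<inter> N \<subseteq> span B" "finite B"
    using edim_finite_obtain_basis[OF fin] by metis
  have span: "span B = M \<inter> N" using span_minimal[OF B(1) MN] B(2) by blast
  obtain S where S: "closed_subspace smul S" "span B \<inter> S = {0}" "\<And>x. \<exists>b\<in>span B. x - b \<in> S"
    using finite_span_complemented[OF B(3)] by blast
  have sub: "M \<inter> N \<subseteq> M + N" using subset_set_plus(1)[OF M N] by blast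
  note subMN = subspace_set_plus[OF M N]
  show ?thesis
  proof
    show "closed_subspace smul (S \<inter> (M + N))"
      using S(1) cl subMN by (auto simp: closed_subspace_def intro: subspace_inter)
    show "(M \<inter> N) \<inter> (S \<inter> (M + N)) = {0}"
      using S(2) subspace_0[OF subMN] unfolding span by blast
    show "M + N = (M \<inter> N) + (S \<inter> (M + N))"
    proof (intro equalityI subsetI)
      fix x assume x: "x \<in> M + N"
      obtain b where b: "b \<in> M \<inter> N" "x - b \<in> S" using S(3)[of x] unfolding span by blast
      then have "x - b \<in> M + N" using x sub by (intro subspace_diff[OF subMN]) auto
      then have "b + (x - b) \<in> (M \<inter> N) + (S \<inter> (M + N))" using b by (intro set_plus_intro) auto
      then show "x \<in> (M \<inter> N) + (S \<inter> (M + N))" by simp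
    next
      fix x assume "x \<in> (M \<inter> N) + (S \<inter> (M + N))"
      then show "x \<in> M + N" using sub subspace_add[OF subMN] by (auto elim!: set_plus_elim)
    qed
  qed
qed

text \<open>The open mapping theorem on the product bounds the quotients, so the supremum is a
  genuine upper bound and can be read off at each w. The component t lies in
  \<open>M \<inter> N\<close>, from which distances are taken later; u and v carry the
  estimates.\<close>

lemma phi_compl_bound:
  assumes "lower_semi_fredholm smul M N"
    and S: "closed_subspace smul S" "M + N = (M \<inter> N) + S" "(M \<inter> N) \<inter> S = {0}"
  shows "0 \<le> phi_compl S M N"
    and "\<And>w. w \<in> M + N \<Longrightarrow> \<exists>u\<in>M. \<exists>t\<in>M \<inter> N. \<exists>v\<in>N. w = u + t + v \<and>
          norm u \<le> phi_compl S M N * norm w \<and> norm v \<le> phi_compl S M N * norm w"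
proof -
  have M: "subspace M" "closed M" and N: "subspace N" "closed N" and cl: "closed (M + N)"
    using assms by (auto simp: lower_semi_fredholm_def closed_subspace_def)
  have S': "subspace S" "closed S" using S(1) by (auto simp: closed_subspace_def)
  note subMN = subspace_set_plus[OF M(1) N(1)]
  note sub = subset_set_plus[OF M(1) N(1)]
  define D where "D = (M \<inter> S) \<times> (M \<inter> N) \<times> (N \<inter> S)"
  define g where "g = inv_into D sum_map"
  have T: "bounded_linear (sum_map :: 'a \<times> 'a \<times> 'a \<Rightarrow> 'a)"
    unfolding sum_map_def case_prod_unfold
    by (intro bounded_linear_add bounded_linear_fst bounded_linear_snd_comp bounded_linear_ident bounded_linear_fst_comp)
  have img: "sum_map ` D = M + N"
  proof (intro equalityI subsetI)
    fix x assume "x \<in> sum_map ` D"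
    then obtain u t v where "u \<in> M" "t \<in> M" "v \<in> N" "x = (u + t) + v"
      by (auto simp: D_def sum_map_def)
    then show "x \<in> M + N" using subspace_add[OF M(1)] by (auto intro: set_plus_intro)
  next
    fix x assume "x \<in> M + N"
    then obtain m n where mn: "m \<in> M" "n \<in> N" "x = m + n" by (auto elim: set_plus_elim)
    have "\<exists>b\<in>M \<inter> N. y - b \<in> S" if "y \<in> M + N" for y
      using that unfolding S(2) by (auto elim!: set_plus_elim) (metis IntI add_diff_cancel_left')
    then obtain b c where b: "b \<in> M \<inter> N" "m - b \<in> S" and c: "c \<in> M \<inter> N" "n - c \<in> S"
      using mn sub by (meson subsetD)
    then have "(m - b, b + c, n - c) \<in> D"
      using mn subspace_diff[OF M(1)] subspace_diff[OF N(1)] subspace_add[OF M(1)] subspace_add[OF N(1)]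
      by (auto simp: D_def)
    moreover have "sum_map (m - b, b + c, n - c) = x" by (simp add: sum_map_def mn)
    ultimately show "x \<in> sum_map ` D" by (metis image_eqI)
  qed
  have inj: "inj_on sum_map D"
  proof (rule inj_onI)
    fix p q assume "p \<in> D" "q \<in> D" and eq: "sum_map p = sum_map q"
    obtain u t v u' t' v' where p: "p = (u, t, v)" and q: "q = (u', t', v')"
      by (metis prod.exhaust)
    have mem: "u \<in> M" "u \<in> S" "t \<in> M" "t \<in> N" "v \<in> N" "v \<in> S"
        "u' \<in> M" "u' \<in> S" "t' \<in> M" "t' \<in> N" "v' \<in> N" "v' \<in> S"
      using \<open>p \<in> D\<close> \<open>q \<in> D\<close> by (auto simp: D_def p q)
    have eq': "(u - u') + (v - v') = t' - t" "u - u' = (t' - t) - (v - v')"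
      using eq by (auto simp: sum_map_def p q algebra_simps)
    have "(u - u') + (v - v') \<in> S"
      using mem by (intro subspace_add[OF S'(1)] subspace_diff[OF S'(1)])
    then have "t' - t \<in> (M \<inter> N) \<inter> S"
      using mem unfolding eq'(1) by (auto intro: subspace_diff M N)
    then have t: "t' = t" using S(3) by auto
    have "u - u' = - (v - v')" using eq'(2) t by simp
    moreover have "u - u' \<in> M" "u - u' \<in> S" using mem by (auto intro: subspace_diff M S')
    moreover have "- (v - v') \<in> N" using mem by (intro subspace_neg subspace_diff N)
    ultimately have "u - u' \<in> (M \<inter> N) \<inter> S" by simp
    then have "u' = u" using S(3) by auto
    then show "p = q" using eq t by (simp add: p q sum_map_def)
  qed
  have "Real_Vector_Spaces.subspace (D :: ('a \<times> 'a \<times> 'a) set)"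
    unfolding D_def using M N S' by (intro subspace_Times real_subspace subspace_inter)
  moreover have "closed D" unfolding D_def using M N S' by (intro closed_Times closed_Int)
  ultimately obtain C where C: "\<And>w. w \<in> sum_map ` D \<Longrightarrow> \<exists>d\<in>D. sum_map d = w \<and> norm d \<le> C * norm w"
    using bounded_linear_open_onto_closed_image[OF T] cl img by metis
  \<comment> \<open>C may be negative when \<open>M + N\<close> is trivial, hence the maximum with
    0.\<close>
  have "max_norm (g w) / norm w \<le> max C 0" if w: "w \<in> M + N" for w
  proof -
    obtain d where d: "d \<in> D" "sum_map d = w" "norm d \<le> C * norm w" using C w img by blast
    then have "g w = d" unfolding g_def using inj by (metis inv_into_f_f)
    moreover have "max_norm d \<le> norm d"
    proof (cases d)
      case (fields u t v)
      then show ?thesis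
        using norm_fst_le[of u "(t, v)"] norm_snd_le[of "(t, v)" u] norm_fst_le[of t v] norm_snd_le[of v t]
        by (auto simp: max_norm_def)
    qed
    moreover have "C * norm w \<le> max C 0 * norm w" by (intro mult_right_mono) auto
    ultimately have "max_norm (g w) \<le> max C 0 * norm w" using d(3) by simp
    then show ?thesis by (cases "norm w = 0") (simp_all add: field_simps)
  qed
  then have bdd: "bdd_above ((\<lambda>w. max_norm (g w) / norm w) ` (M + N))" by (intro bdd_aboveI2)
  have phi: "phi_compl S M N = (SUP w\<in>M + N. max_norm (g w) / norm w)"
    by (simp add: phi_compl_def g_def D_def)
  have le: "max_norm (g w) / norm w \<le> phi_compl S M N" if "w \<in> M + N" for w
    unfolding phi by (rule cSUP_upper[OF that bdd])
  \<comment> \<open>At w = 0 the quotient is 0 by the convention on division, so the supremum is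
    nonnegative.\<close>
  show "0 \<le> phi_compl S M N" using le[of 0] subspace_0[OF subMN] by simp
  show "\<exists>u\<in>M. \<exists>t\<in>M \<inter> N. \<exists>v\<in>N. w = u + t + v \<and>
      norm u \<le> phi_compl S M N * norm w \<and> norm v \<le> phi_compl S M N * norm w" if w: "w \<in> M + N" for w
  proof (cases "w = 0")
    case True
    then show ?thesis using subspace_0[OF M(1)] subspace_0[OF N(1)]
      by (intro bexI[of _ 0]) auto
  next
    case False
    have "g w \<in> D" "sum_map (g w) = w"
      using w unfolding g_def by (metis inv_into_into img, metis f_inv_into_f img)
    then obtain u t v where utv: "g w = (u, t, v)" "u \<in> M" "t \<in> M \<inter> N" "v \<in> N" "u + t + v = w"
      by (auto simp: D_def sum_map_def)
    have "max_norm (g w) \<le> phi_compl S M N * norm w"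
      using le[OF w] False by (simp add: field_simps)
    then have "norm u \<le> phi_compl S M N * norm w" "norm v \<le> phi_compl S M N * norm w"
      by (auto simp: max_norm_def utv(1))
    then show ?thesis using utv by blast
  qed
qed

text \<open>The infimum need not be attained, but any r above it leaves room for an admissible
  complement with constant q below r.\<close>

lemma phi_approx:
  assumes lsf: "lower_semi_fredholm smul M N" and "phi smul M N < r"
  obtains q where "0 \<le> q" "q < r"
    "\<forall>w\<in>M + N. \<exists>u\<in>M. \<exists>t\<in>M \<inter> N. \<exists>v\<in>N. w = u + t + v \<and> norm u \<le> q * norm w \<and> norm v \<le> q * norm w"
proof -
  define A where "A = {phi_compl S M N | S. closed_subspace smul S \<and>
            M + N = (M \<inter> N) + S \<and> (M \<inter> N) \<inter> S = {0}}"
  obtain S0 where "closed_subspace smul S0" "M + N = (M \<inter> N) + S0" "(M \<inter> N) \<inter> S0 = {0}"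
    by (rule phi_admissible_nonempty[OF lsf])
  then have "phi_compl S0 M N \<in> A" unfolding A_def by (intro CollectI exI[of _ S0] conjI refl)
  then have "A \<noteq> {}" by blast
  moreover have "Inf A < r" using assms(2) by (simp add: phi_def A_def)
  ultimately obtain q where q: "q \<in> A" "q < r" using cInf_lessD by blast
  then obtain S where S: "q = phi_compl S M N" "closed_subspace smul S" "M + N = (M \<inter> N) + S"
      "(M \<inter> N) \<inter> S = {0}"
    unfolding A_def by (elim CollectE exE conjE)
  note bound = phi_compl_bound[OF lsf S(2-4), folded S(1)]
  show ?thesis by (rule that[OF bound(1) q(2) ballI[OF bound(2)]])
qed

end

section \<open>Relations close to the identity\<close>

context banach_scaling
begin

text \<open>Closed linear relations whose elements \<open>(x, y)\<close> have relatively close coordinates; for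
  \<open>e < 1\<close> these are the graphs of the closed isomorphisms close to the identity.\<close>

definition near_graph :: "real \<Rightarrow> ('a \<times> 'a) set \<Rightarrow> bool" where
  "near_graph e G \<longleftrightarrow> closed G \<and> (0, 0) \<in> G \<and>
     (\<forall>x y x' y'. (x, y) \<in> G \<longrightarrow> (x', y') \<in> G \<longrightarrow> (x + x', y + y') \<in> G) \<and>
     (\<forall>c x y. (x, y) \<in> G \<longrightarrow> (smul c x, smul c y) \<in> G) \<and>
     (\<forall>x y. (x, y) \<in> G \<longrightarrow> norm (x - y) \<le> e * norm x \<and> norm (x - y) \<le> e * norm y)"

lemma near_graphD:
  assumes "near_graph e G"
  shows "closed G" "(0, 0) \<in> G"
    "(x, y) \<in> G \<Longrightarrow> (x', y') \<in> G \<Longrightarrow> (x + x', y + y') \<in> G"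
    "(x, y) \<in> G \<Longrightarrow> (smul c x, smul c y) \<in> G"
    "(x, y) \<in> G \<Longrightarrow> norm (x - y) \<le> e * norm x"
    "(x, y) \<in> G \<Longrightarrow> norm (x - y) \<le> e * norm y"
  using assms by (simp_all add: near_graph_def)

lemma near_graph_diff:
  assumes "near_graph e G" "(x, y) \<in> G" "(x', y') \<in> G"
  shows "(x - x', y - y') \<in> G"
  using near_graphD(3)[OF assms(1,2) near_graphD(4)[OF assms(1,3), of "- 1"]] by simp

text \<open>The estimate in \<open>near_graph\<close> is relative to both coordinates so that the
  notion is symmetric: facts about images then apply to preimages.\<close>

lemma near_graph_converse:
  assumes G: "near_graph e G"
  shows "near_graph e (G\<inverse>)"
proof -
  have "closed (prod.swap -` G)"
    using near_graphD(1)[OF G] by (intro closed_vimage continuous_on_swap)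
  also have "prod.swap -` G = G\<inverse>" by auto
  finally show ?thesis
    using G unfolding near_graph_def converse_iff by (metis norm_minus_commute)
qed

lemma subspace_near_graph_Image:
  assumes G: "near_graph e G" and L: "subspace L"
  shows "subspace (G `` L)"
proof (rule subspaceI)
  show "0 \<in> G `` L" using near_graphD(2)[OF G] subspace_0[OF L] by blast
  show "x + y \<in> G `` L" if "x \<in> G `` L" "y \<in> G `` L" for x y
    using that near_graphD(3)[OF G] subspace_add[OF L] by blast
  show "smul c x \<in> G `` L" if "x \<in> G `` L" for c x
    using that near_graphD(4)[OF G] subspace_scale[OF L] by blast
qed

lemma near_graph_norm_le:
  assumes G: "near_graph e G" and e: "e \<le> 1 / 2" and xy: "(x, y) \<in> G"
  shows "norm x \<le> 2 * norm y"
proof -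
  have "norm x \<le> norm (x - y) + norm y" using norm_triangle_sub[of x y] by (simp add: add.commute)
  also have "norm (x - y) \<le> 1 / 2 * norm x"
    using near_graphD(5)[OF G xy] mult_right_mono[OF e norm_ge_zero[of x]] by linarith
  finally show ?thesis by simp
qed

text \<open>For e \<le> 1 / 2 a preimage has at most twice the norm of its image, so the preimages
  of a convergent sequence are Cauchy.\<close>

lemma closed_near_graph_Image:
  assumes G: "near_graph e G" and e: "e \<le> 1 / 2" and L: "closed L"
  shows "closed (G `` L)"
  unfolding closed_sequential_limits
proof (intro allI impI, elim conjE)
  fix y l assume y: "\<forall>n. y n \<in> G `` L" and l: "y \<longlonglongrightarrow> l"
  then obtain x where x: "\<And>n. x n \<in> L" "\<And>n. (x n, y n) \<in> G"
    by (auto simp: Image_iff Bex_def choice_iff)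
  have "Cauchy x"
  proof (rule metric_CauchyI)
    fix r :: real assume "r > 0"
    then obtain K where K: "\<And>m n. m \<ge> K \<Longrightarrow> n \<ge> K \<Longrightarrow> dist (y m) (y n) < r / 2"
      using metric_CauchyD[OF LIMSEQ_imp_Cauchy[OF l], of "r / 2"] by auto
    have "dist (x m) (x n) < r" if "m \<ge> K" "n \<ge> K" for m n
      using K[OF that] near_graph_norm_le[OF G e near_graph_diff[OF G x(2) x(2)], of m n]
      by (simp add: dist_norm)
    then show "\<exists>K. \<forall>m\<ge>K. \<forall>n\<ge>K. dist (x m) (x n) < r" by blast
  qed
  then obtain k where k: "x \<longlonglongrightarrow> k" using Cauchy_convergent_iff convergent_def by blast
  have "k \<in> L" by (rule closed_sequentially[OF L _ k]) (rule x)
  moreover have "(k, l) \<in> G"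
    by (rule closed_sequentially[OF near_graphD(1)[OF G] _ tendsto_Pair[OF k l]]) (rule x)
  ultimately show "l \<in> G `` L" by blast
qed

text \<open>At y = 0 the estimate relative to y forces x = 0 for every e. So G is injective, and a
  basis of the image lifts to vectors whose span contains L.\<close>

lemma edim_le_near_graph_Image:
  assumes G: "near_graph e G" and L: "L \<subseteq> Domain G"
  shows "edim smul L \<le> edim smul (G `` L)"
proof (cases "edim smul (G `` L) < \<infinity>")
  case True
  then obtain C where C: "C \<subseteq> G `` L" "G `` L \<subseteq> span C" "finite C" "edim smul (G `` L) = enat (card C)"
    using edim_finite_obtain_basis by metis
  then have "\<forall>y\<in>C. \<exists>x. (x, y) \<in> G" by blast
  then obtain g where g: "\<And>y. y \<in> C \<Longrightarrow> (g y, y) \<in> G"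
    by (auto simp: bchoice_iff)
  have lift: "\<exists>x\<in>span (g ` C). (x, y) \<in> G" if "y \<in> span C" for y
    using that
  proof (induction rule: span_induct_alt)
    case base
    then show ?case using near_graphD(2)[OF G] span_zero by blast
  next
    case (step c y z)
    then obtain x where x: "x \<in> span (g ` C)" "(x, z) \<in> G" by blast
    have "(smul c (g y) + x, smul c y + z) \<in> G"
      using near_graphD(3,4)[OF G] g step x by blast
    moreover have "smul c (g y) + x \<in> span (g ` C)"
      using step x by (intro span_add span_scale) (auto intro: span_base)
    ultimately show ?case by blast
  qed
  have "L \<subseteq> span (g ` C)"
  proof
    fix x assume "x \<in> L"
    then obtain y where y: "(x, y) \<in> G" using L by blast
    then have "y \<in> span C" using C(2) \<open>x \<in> L\<close> by blast
    then obtain x' where x': "x' \<in> span (g ` C)" "(x', y) \<in> G" using lift by blast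
    have "(x - x', 0) \<in> G" using near_graph_diff[OF G y x'(2)] by simp
    from near_graphD(6)[OF G this] show "x \<in> span (g ` C)" using x'(1) by simp
  qed
  then have "\<not> enat (card C) < edim smul L"
    using not_subset_span_if_less_edim C(3) card_image_le by blast
  then show ?thesis using C(4) by simp
qed (auto simp: less_le)

section \<open>Sums that are not closed\<close>

lemma closed_set_plus_if_separated:
  assumes M: "subspace M" "closed M" and N: "subspace N" "closed N" and d: "d > 0"
    and sep: "\<And>x y. x \<in> M \<Longrightarrow> y \<in> N \<Longrightarrow> d * norm x \<le> norm (x - y)"
  shows "closed (M + N)"
  unfolding closed_sequential_limits
proof (intro allI impI, elim conjE)
  fix w l assume w: "\<forall>n. w n \<in> M + N" and l: "w \<longlonglongrightarrow> l"
  have "\<exists>x. x \<in> M \<and> w n - x \<in> N" for n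
  proof -
    obtain m k where "m \<in> M" "k \<in> N" "w n = m + k" using w by (meson set_plus_elim)
    then show ?thesis by (intro exI[of _ m]) simp
  qed
  then obtain x where x: "\<And>n. x n \<in> M" "\<And>n. w n - x n \<in> N" by metis
  have le: "d * norm (x m - x n) \<le> norm (w m - w n)" for m n
  proof -
    have "- ((w m - x m) - (w n - x n)) \<in> N" by (intro subspace_neg subspace_diff N x)
    then have "d * norm (x m - x n) \<le> norm ((x m - x n) - (- ((w m - x m) - (w n - x n))))"
      by (intro sep subspace_diff M x)
    also have "(x m - x n) - (- ((w m - x m) - (w n - x n))) = w m - w n" by simp
    finally show ?thesis .
  qed
  have "Cauchy x"
  proof (rule metric_CauchyI)
    fix r :: real assume "r > 0"
    then obtain K where K: "\<And>m n. m \<ge> K \<Longrightarrow> n \<ge> K \<Longrightarrow> dist (w m) (w n) < d * r"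
      using metric_CauchyD[OF LIMSEQ_imp_Cauchy[OF l], of "d * r"] d by auto
    have "dist (x m) (x n) < r" if "m \<ge> K" "n \<ge> K" for m n
    proof -
      have "d * norm (x m - x n) < d * r" using K[OF that] le[of m n] by (simp add: dist_norm)
      then show ?thesis using d by (simp add: dist_norm)
    qed
    then show "\<exists>K. \<forall>m\<ge>K. \<forall>n\<ge>K. dist (x m) (x n) < r" by blast
  qed
  then obtain k where k: "x \<longlonglongrightarrow> k" using Cauchy_convergent_iff convergent_def by blast
  have "k \<in> M" by (rule closed_sequentially[OF M(2) _ k]) (rule x)
  moreover have "l - k \<in> N"
    by (rule closed_sequentially[OF N(2) _ tendsto_diff[OF l k]]) (rule x)
  ultimately have "k + (l - k) \<in> M + N" by (rule set_plus_intro)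
  then show "l \<in> M + N" by simp
qed

lemma close_unit_vectors_if_not_closed:
  assumes M: "subspace M" "closed M" and N: "subspace N" "closed N"
    and ncl: "\<not> closed (M + N)" and d: "d > 0"
  obtains x y where "x \<in> M" "norm x = 1" "y \<in> N" "norm (x - y) < d"
proof -
  obtain x y where xy: "x \<in> M" "y \<in> N" "norm (x - y) < d * norm x"
    using closed_set_plus_if_separated[OF M N d] ncl by (metis not_le)
  then have pos: "norm x > 0" using d by (metis mult_zero_right norm_ge_zero not_less less_le)
  define c :: 'k where "c = of_real (1 / norm x)"
  have "norm c = 1 / norm x" unfolding c_def norm_of_real by simp
  moreover have "norm (smul c x - smul c y) = norm c * norm (x - y)"
    by (simp flip: norm_smul scale_right_diff_distrib)
  ultimately have "norm (smul c x) = 1" "norm (smul c x - smul c y) < d"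
    using pos xy(3) by (simp_all add: norm_smul divide_less_eq)
  then show ?thesis
    using xy by (intro that[of "smul c x" "smul c y"]) (auto intro: subspace_scale M N)
qed

text \<open>Cutting M by the kernel loses only the line through z, and a closed subspace plus a line
  is closed. This lets the recursive choice of nearly common vectors continue forever.\<close>

lemma not_closed_Int_ker:
  assumes M: "subspace M" "closed M" and N: "subspace N" "closed N"
    and f: "linear f" "\<And>x. \<bar>f x\<bar> \<le> norm x" and z: "z \<in> M" "f z \<noteq> 0"
    and ncl: "\<not> closed (M + N)"
  shows "\<not> closed ((M \<inter> ker f) + N)"
proof
  assume cl: "closed ((M \<inter> ker f) + N)"
  have K: "subspace (ker f)" using closed_subspace_ker[OF f] by (simp add: closed_subspace_def)
  have "M + N = {x. \<exists>k. x - smul k z \<in> (M \<inter> ker f) + N}"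
  proof (intro equalityI subsetI CollectI)
    fix x assume "x \<in> M + N"
    then obtain m n where mn: "m \<in> M" "n \<in> N" "x = m + n" by (auto elim: set_plus_elim)
    obtain k where k: "m - smul k z \<in> ker f" using ker_decompose[OF f(1) z(2)] by blast
    have "m - smul k z \<in> M" using mn z by (intro subspace_diff subspace_scale M)
    then have "(m - smul k z) + n \<in> (M \<inter> ker f) + N" using k mn by (intro set_plus_intro) auto
    then show "\<exists>k. x - smul k z \<in> (M \<inter> ker f) + N"
      by (intro exI[of _ k]) (simp add: mn algebra_simps)
  next
    fix x assume "x \<in> {x. \<exists>k. x - smul k z \<in> (M \<inter> ker f) + N}"
    then obtain k m n where mn: "m \<in> M" "n \<in> N" "x - smul k z = m + n" by (auto elim: set_plus_elim)
    have "(m + smul k z) + n \<in> M + N"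
      using mn z by (intro set_plus_intro subspace_add[OF M(1)] subspace_scale[OF M(1)])
    then show "x \<in> M + N" using mn(3) by (simp add: algebra_simps)
  qed
  then show False
    using closed_add_line[OF subspace_set_plus[OF subspace_inter[OF M(1) K] N(1)] cl] ncl by simp
qed

text \<open>Membership in the kernels bounds the coefficients of a combination by its norm. Errors
  shrinking like 4^-n therefore move every combination of the x n, and not only each x n, by a small
  fraction of its norm, and this estimate survives the closure.\<close>

lemma near_graph_exists_if_not_closed:
  assumes M: "subspace M" "closed M" and N: "subspace N" "closed N"
    and ncl: "\<not> closed (M + N)" and e: "e > 0"
  obtains G where "near_graph e G" "G \<subseteq> M \<times> N" "edim smul (Domain G) = \<infinity>"
proof -
  \<comment> \<open>The estimate relative to the second coordinate loses a factor 2, hence e / 2;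
    the bound 1 / 2 is what yields that factor.\<close>
  define b where "b = min (e / 2) (1 / 2)"
  have b: "b > 0" "b \<le> e / 2" "b \<le> 1 / 2" using e by (auto simp: b_def)
  define P where "P n s \<longleftrightarrow> (case s of (M', x, y, f) \<Rightarrow> subspace M' \<and> closed M' \<and> M' \<subseteq> M \<and>
      \<not> closed (M' + N) \<and> x \<in> M' \<and> norm x = 1 \<and> y \<in> N \<and> norm (x - y) < b / (2 * 4 ^ n) \<and>
      linear f \<and> (\<forall>x. \<bar>f x\<bar> \<le> norm x) \<and> f x = 1)"
    for n :: nat and s :: "'a set \<times> 'a \<times> 'a \<times> ('a \<Rightarrow> real)"
  define Q where "Q s s' \<longleftrightarrow> (case s of (M', x, y, f) \<Rightarrow> fst s' = M' \<inter> ker f)"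
    for s s' :: "'a set \<times> 'a \<times> 'a \<times> ('a \<Rightarrow> real)"
  have extend: "\<exists>s. P n s \<and> fst s = M'"
    if M': "subspace M'" "closed M'" "M' \<subseteq> M" "\<not> closed (M' + N)" for M' n
  proof -
    have "b / (2 * 4 ^ n) > 0" using b by simp
    then obtain x y where xy: "x \<in> M'" "norm x = 1" "y \<in> N" "norm (x - y) < b / (2 * 4 ^ n)"
      using close_unit_vectors_if_not_closed[OF M'(1,2) N M'(4)] by metis
    obtain f :: "'a \<Rightarrow> real" where "linear f" "\<And>x. \<bar>f x\<bar> \<le> norm x" "f x = norm x"
      using norming_functional_exists by blast
    then have "P n (M', x, y, f)" using M' xy by (simp add: P_def)
    then show ?thesis by (intro exI[of _ "(M', x, y, f)"]) simp
  qed
  have "\<exists>s. \<forall>n. P n (s n) \<and> Q (s n) (s (Suc n))"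
  proof (rule dependent_nat_choice)
    show "\<exists>s. P 0 s" using extend[OF M order_refl ncl] by blast
  next
    fix s n assume "P n s"
    then obtain M' x y f where s: "s = (M', x, y, f)" and *: "subspace M'" "closed M'" "M' \<subseteq> M"
      "\<not> closed (M' + N)" "x \<in> M'" "linear f" "\<And>x. \<bar>f x\<bar> \<le> norm x" "f x = 1"
      by (auto simp: P_def)
    have K: "subspace (ker f)" "closed (ker f)"
      using closed_subspace_ker[OF *(6,7)] by (auto simp: closed_subspace_def)
    have "\<not> closed ((M' \<inter> ker f) + N)"
      using *(8) by (intro not_closed_Int_ker[OF *(1,2) N *(6,7) *(5) _ *(4)]) auto
    moreover have "subspace (M' \<inter> ker f)" "closed (M' \<inter> ker f)" "M' \<inter> ker f \<subseteq> M"
      using * K by (auto intro: subspace_inter)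
    ultimately show "\<exists>s'. P (Suc n) s' \<and> Q s s'"
      using extend[of "M' \<inter> ker f" "Suc n"] by (auto simp: Q_def s)
  qed
  then obtain s where s: "\<And>n. P n (s n)" "\<And>n. Q (s n) (s (Suc n))" by blast
  define Mk where "Mk n = fst (s n)" for n
  define x where "x n = fst (snd (s n))" for n
  define y where "y n = fst (snd (snd (s n)))" for n
  define f where "f n = snd (snd (snd (s n)))" for n
  have s_eq: "s n = (Mk n, x n, y n, f n)" for n
    by (simp add: Mk_def x_def y_def f_def)
  have Mk: "subspace (Mk n)" "Mk n \<subseteq> M" and x: "x n \<in> Mk n" "norm (x n) = 1"
    and y: "y n \<in> N" "norm (x n - y n) < b / (2 * 4 ^ n)"
    and f: "linear (f n)" "\<And>x. \<bar>f n x\<bar> \<le> norm x" "f n (x n) = 1" for n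
    using s(1)[of n] by (auto simp: s_eq P_def)
  have Mk_Suc: "Mk (Suc n) = Mk n \<inter> ker (f n)" for n
    using s(2)[of n] by (simp add: s_eq Q_def)
  have "Mk j \<subseteq> Mk i" if "i \<le> j" for i j
    using that by (induction rule: dec_induct) (auto simp: Mk_Suc)
  then have x_Mk: "x j \<in> Mk i" if "i \<le> j" for i j using that x by blast
  \<comment> \<open>Induction on the length with arbitrary start k, peeling off the first term. This
    at most doubles the norm of the sum, and the weights fit: b / (2 * 4^k) + 2 * b / 4^(k + 1) = b
    / 4^k.\<close>
  have bound: "norm (\<Sum>i\<in>{k..<k + d}. smul (a i) (x i - y i))
      \<le> b / 4 ^ k * norm (\<Sum>i\<in>{k..<k + d}. smul (a i) (x i))" for k d a
  proof (induction d arbitrary: k)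
    case 0
    then show ?case by simp
  next
    case (Suc d)
    have split: "(\<Sum>i\<in>{k..<k + Suc d}. g i) = g k + (\<Sum>i\<in>{Suc k..<Suc k + d}. g i)" for g :: "nat \<Rightarrow> 'a"
      by (simp add: sum.atLeast_Suc_lessThan)
    define v where "v = (\<Sum>i\<in>{k..<k + Suc d}. smul (a i) (x i))"
    define v' where "v' = (\<Sum>i\<in>{Suc k..<Suc k + d}. smul (a i) (x i))"
    have v: "v = smul (a k) (x k) + v'" unfolding v_def v'_def by (rule split)
    have "v' \<in> Mk (Suc k)"
      unfolding v'_def by (intro subspace_sum subspace_scale Mk x_Mk) simp
    then have v': "v' \<in> ker (f k)" by (simp add: Mk_Suc)
    \<comment> \<open>\<open>f k\<close> vanishes on all multiples of \<open>v'\<close> and is 1 at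
      \<open>x k\<close>. Dividing v by \<open>a k\<close> first makes its value there exactly 1,
      although \<open>f k\<close> is only real-linear.\<close>
    have ak: "norm (a k) \<le> norm v"
    proof (cases "a k = 0")
      case False
      have "f k (smul (inverse (a k)) v) = f k (x k) + f k (smul (inverse (a k)) v')"
        using False by (simp add: v scale_right_distrib linear_add[OF f(1)])
      also have "\<dots> = 1" using v' by (simp add: ker_def f(3))
      finally have "1 \<le> norm (smul (inverse (a k)) v)" using f(2)[of k "smul (inverse (a k)) v"] by simp
      then have "norm (a k) * 1 \<le> norm (a k) * (inverse (norm (a k)) * norm v)"
        unfolding norm_smul norm_inverse by (intro mult_left_mono) auto
      then show ?thesis using False by (simp flip: mult.assoc)
    qed simp
    have "v' = v - smul (a k) (x k)" by (simp add: v)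
    then have "norm v' \<le> norm v + norm (a k)"
      using norm_triangle_ineq4[of v "smul (a k) (x k)"] by (simp add: norm_smul x(2))
    then have v'2: "norm v' \<le> 2 * norm v" using ak by simp
    have "norm (\<Sum>i\<in>{k..<k + Suc d}. smul (a i) (x i - y i))
        \<le> norm (smul (a k) (x k - y k)) + norm (\<Sum>i\<in>{Suc k..<Suc k + d}. smul (a i) (x i - y i))"
      unfolding split by (rule norm_triangle_ineq)
    also have "\<dots> \<le> norm v * (b / (2 * 4 ^ k)) + b / 4 ^ Suc k * (2 * norm v)"
    proof (rule add_mono)
      show "norm (smul (a k) (x k - y k)) \<le> norm v * (b / (2 * 4 ^ k))"
        unfolding norm_smul using ak y(2)[of k] by (intro mult_mono) auto
      have "norm (\<Sum>i\<in>{Suc k..<Suc k + d}. smul (a i) (x i - y i)) \<le> b / 4 ^ Suc k * norm v'"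
        unfolding v'_def by (rule Suc.IH)
      also have "\<dots> \<le> b / 4 ^ Suc k * (2 * norm v)"
        using v'2 b(1) by (intro mult_left_mono) auto
      finally show "norm (\<Sum>i\<in>{Suc k..<Suc k + d}. smul (a i) (x i - y i)) \<le> b / 4 ^ Suc k * (2 * norm v)" .
    qed
    also have "\<dots> = b / 4 ^ k * norm v" by (simp add: field_simps)
    finally show ?case unfolding v_def .
  qed
  define S where "S a m = ((\<Sum>i<m. smul (a i) (x i)), (\<Sum>i<m. smul (a i) (y i)))" for a and m :: nat
  define G0 where "G0 = {S a m | a m. True}"
  \<comment> \<open>Padding with zero coefficients brings two combinations to a common
    length.\<close>
  have S_extend: "S a m = S (\<lambda>i. if i < m then a i else 0) k" if "m \<le> k" for a m k
    unfolding S_def using that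
    by (intro arg_cong2[where f = Pair] sum.mono_neutral_cong_left) auto
  have G0_add: "p + q \<in> G0" if "p \<in> G0" "q \<in> G0" for p q
  proof -
    from that obtain a m a' m' where "p = S a m" "q = S a' m'" by (auto simp: G0_def)
    then have "p = S (\<lambda>i. if i < m then a i else 0) (max m m')"
        "q = S (\<lambda>i. if i < m' then a' i else 0) (max m m')"
      using S_extend by auto
    then have "p + q = S (\<lambda>i. (if i < m then a i else 0) + (if i < m' then a' i else 0)) (max m m')"
      by (simp add: S_def scale_left_distrib sum.distrib)
    then show ?thesis by (auto simp: G0_def)
  qed
  have G0_scale: "(smul c (fst p), smul c (snd p)) \<in> G0" if p: "p \<in> G0" for c p
  proof -
    from p obtain a m where "p = S a m" by (auto simp: G0_def)
    then have "(smul c (fst p), smul c (snd p)) = S (\<lambda>i. c * a i) m"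
      by (simp add: S_def scale_sum_right)
    then show ?thesis by (auto simp: G0_def)
  qed
  have G0_near: "norm (fst p - snd p) \<le> b * norm (fst p)" if p: "p \<in> G0" for p
  proof -
    from p obtain a m where "p = S a m" by (auto simp: G0_def)
    then show ?thesis using bound[where k = 0 and d = m and a = a]
      by (simp add: S_def scale_right_diff_distrib sum_subtractf atLeast0LessThan)
  qed
  have G0_sub: "G0 \<subseteq> M \<times> N"
    unfolding G0_def S_def using Mk x y
    by (auto intro!: subspace_sum[OF M(1)] subspace_sum[OF N(1)] subspace_scale[OF M(1)] subspace_scale[OF N(1)])
  define G where "G = closure G0"
  have G_sub: "G \<subseteq> M \<times> N"
    unfolding G_def using G0_sub M(2) N(2) by (intro closure_minimal closed_Times)
  have "G \<subseteq> {p. norm (fst p - snd p) \<le> b * norm (fst p)}"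
    unfolding G_def using G0_near
    by (intro closure_minimal closed_Collect_le continuous_intros) auto
  then have near: "norm (u - w) \<le> b * norm u" if "(u, w) \<in> G" for u w
    using that by auto
  have "near_graph e G"
    unfolding near_graph_def
  proof (intro conjI allI impI)
    show "closed G" by (simp add: G_def)
    have "S (\<lambda>_. 0) 0 \<in> G0" by (auto simp: G0_def)
    then show "(0, 0) \<in> G" using closure_subset[of G0] by (auto simp: S_def G_def)
    show "(u + u', w + w') \<in> G" if "(u, w) \<in> G" "(u', w') \<in> G" for u w u' w'
    proof -
      from that obtain p q where "\<And>n. p n \<in> G0" "p \<longlonglongrightarrow> (u, w)" "\<And>n. q n \<in> G0" "q \<longlonglongrightarrow> (u', w')"
        unfolding G_def closure_sequential by blast
      then show ?thesis
        unfolding G_def closure_sequential using G0_add tendsto_add[of p "(u, w)" sequentially q "(u', w')"]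
        by (intro exI[of _ "\<lambda>n. p n + q n"]) simp
    qed
    show "(smul c u, smul c w) \<in> G" if "(u, w) \<in> G" for c u w
    proof -
      from that obtain p where p: "\<And>n. p n \<in> G0" "p \<longlonglongrightarrow> (u, w)"
        unfolding G_def closure_sequential by blast
      have "(\<lambda>n. (smul c (fst (p n)), smul c (snd (p n)))) \<longlonglongrightarrow> (smul c (fst (u, w)), smul c (snd (u, w)))"
        by (intro tendsto_Pair tendsto_smul tendsto_const tendsto_fst tendsto_snd p)
      then show ?thesis
        unfolding G_def closure_sequential using G0_scale[OF p(1)]
        by (intro exI[of _ "\<lambda>n. (smul c (fst (p n)), smul c (snd (p n)))"]) simp
    qed
    fix u w assume uw: "(u, w) \<in> G"
    have bu: "b * norm u \<le> 1 / 2 * norm u" "b * norm u \<le> e / 2 * norm u"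
      using b by (intro mult_right_mono; simp)+
    moreover have "e / 2 * norm u \<le> e * norm u" using e by (intro mult_right_mono) auto
    ultimately show "norm (u - w) \<le> e * norm u" using near[OF uw] by linarith
    have "norm u \<le> norm (u - w) + norm w" using norm_triangle_sub[of u w] by (simp add: add.commute)
    then have "norm u \<le> 2 * norm w" using near[OF uw] bu by simp
    then have "e / 2 * norm u \<le> e / 2 * (2 * norm w)" using e by (intro mult_left_mono) auto
    then show "norm (u - w) \<le> e * norm w" using near[OF uw] bu by simp
  qed
  moreover have "edim smul (Domain G) = \<infinity>"
  proof -
    have xD: "x k \<in> Domain G" for k
    proof -
      have "fst (S (\<lambda>i. if i = k then 1 else 0) (Suc k)) = x k"
        by (simp add: S_def if_distrib[of "\<lambda>c. smul c _"] sum.delta cong: if_cong)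
      moreover have "S (\<lambda>i. if i = k then 1 else 0) (Suc k) \<in> G"
        using closure_subset[of G0] by (auto simp: G_def G0_def)
      ultimately show ?thesis by (metis Domain.DomainI prod.collapse)
    qed
    \<comment> \<open>Independence is built from the last vector to the first: \<open>f k\<close>
      vanishes on all later vectors but not on \<open>x k\<close>.\<close>
    have ind: "independent (x ` {k..<k + d}) \<and> card (x ` {k..<k + d}) = d" for k d
    proof (induction d arbitrary: k)
      case 0
      then show ?case by (simp add: independent_empty)
    next
      case (Suc d)
      have "span (x ` {Suc k..<Suc k + d}) \<subseteq> Mk (Suc k)"
        using x_Mk by (intro span_minimal Mk) auto
      then have "span (x ` {Suc k..<Suc k + d}) \<subseteq> ker (f k)" by (auto simp: Mk_Suc)
      then have "x k \<notin> span (x ` {Suc k..<Suc k + d})"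
        using ker_zero[of "x k" "f k"] f(3)[of k] by auto
      moreover have "{k..<k + Suc d} = insert k {Suc k..<Suc k + d}" by auto
      ultimately show ?case
        using Suc.IH[of "Suc k"] independent_insertI span_base by (auto simp: card_insert_if)
    qed
    have "enat d \<le> edim smul (Domain G)" for d
      using card_le_edim[of "x ` {0..<0 + d}" "Domain G"] ind[of 0 d] xD by auto
    then show ?thesis by (metis enat_ile linorder_not_less enat_ord_simps(4) Suc_ile_eq less_irrefl enat.exhaust)
  qed
  ultimately show ?thesis using that G_sub by blast
qed

lemma near_graph_Id_on:
  assumes L: "subspace L" "closed L" and e: "e \<ge> 0"
  shows "near_graph e (Id_on L)"
proof -
  have "Id_on L = (L \<times> L) \<inter> {p. fst p = snd p}" by auto
  moreover have "closed \<dots>"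
    using L(2) by (intro closed_Int closed_Times closed_Collect_eq continuous_intros)
  ultimately show ?thesis
    using e subspace_0[OF L(1)] subspace_add[OF L(1)] subspace_scale[OF L(1)]
    by (auto simp: near_graph_def)
qed

lemma near_graph_exists_if_not_lower_semi_fredholm:
  assumes M: "closed_subspace smul M" and N: "closed_subspace smul N"
    and "\<not> lower_semi_fredholm smul M N" and e: "e > 0"
  obtains G where "near_graph e G" "G \<subseteq> M \<times> N" "edim smul (Domain G) = \<infinity>"
proof (cases "closed (M + N)")
  case True
  then have "edim smul (M \<inter> N) = \<infinity>"
    using assms by (simp add: lower_semi_fredholm_def lower_defect_def)
  moreover have "near_graph e (Id_on (M \<inter> N))"
    using M N e by (intro near_graph_Id_on) (auto simp: closed_subspace_def intro: subspace_inter)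
  ultimately show ?thesis by (intro that[of "Id_on (M \<inter> N)"]) (auto simp: Domain_Id_on)
next
  case False
  then show ?thesis
    using near_graph_exists_if_not_closed[of M N e] M N e that by (auto simp: closed_subspace_def)
qed

end

section \<open>Adjusted sequences of subspaces\<close>

lemma eventually_along:
  "eventually P (along I) \<longleftrightarrow> (\<exists>m. \<forall>n\<in>I. n \<ge> m \<longrightarrow> P n)"
  unfolding along_def eventually_inf_principal eventually_sequentially by blast

lemma along_mono: "I \<subseteq> J \<Longrightarrow> along I \<le> along J"
  unfolding along_def by (intro inf_mono) auto

lemma infinite_eventually_along:
  assumes "infinite I" "eventually P (along I)"
  shows "infinite {n\<in>I. P n}"
proof -
  obtain m where m: "\<forall>n\<in>I. n \<ge> m \<longrightarrow> P n" using assms(2) by (auto simp: eventually_along)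
  have "I \<subseteq> {n\<in>I. P n} \<union> {..<m}" using m by force
  then show ?thesis using assms(1) finite_subset by blast
qed

lemma lower_uniformly_adjustedD:
  assumes "lower_uniformly_adjusted I M P l" "\<eta> > 0" "J \<subseteq> I" "infinite J"
    "\<forall>n\<in>J. x n \<in> M n \<and> norm (x n) = 1"
  shows "\<exists>J'\<subseteq>J. infinite J' \<and> (\<exists>y z. (\<forall>n\<in>J'. y n \<in> P n) \<and>
      Limsup (along J') (\<lambda>n. ereal (norm (x n - y n - z))) \<le> ereal (l + \<eta>))"
  using assms(1)[unfolded lower_uniformly_adjusted_def, THEN spec, THEN mp, OF assms(2),
      THEN spec, THEN mp, OF assms(3), THEN mp, OF assms(4), THEN spec, THEN mp, OF assms(5)] .

lemma lower_uniformly_adjusted_antimono: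
  assumes "lower_uniformly_adjusted I M P l" "I' \<subseteq> I" "\<And>n. n \<in> I' \<Longrightarrow> L n \<subseteq> M n"
  shows "lower_uniformly_adjusted I' L P l"
  unfolding lower_uniformly_adjusted_def
proof (intro allI impI)
  fix \<eta> :: real and J x
  assume "\<eta> > 0" and J: "J \<subseteq> I'" "infinite J" and x: "\<forall>n\<in>J. x n \<in> L n \<and> norm (x n) = 1"
  then have "J \<subseteq> I" "\<forall>n\<in>J. x n \<in> M n \<and> norm (x n) = 1" using assms(2,3) by blast+
  then show "\<exists>I''\<subseteq>J. infinite I'' \<and> (\<exists>y z. (\<forall>n\<in>I''. y n \<in> P n) \<and>
      Limsup (along I'') (\<lambda>n. ereal (norm (x n - y n - z))) \<le> ereal (l + \<eta>))"
    by (intro lower_uniformly_adjustedD[OF assms(1) \<open>\<eta> > 0\<close> _ J(2)])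
qed

lemma lower_uniformly_adjusted_mono:
  assumes "lower_uniformly_adjusted I M P l" "l \<le> l'"
  shows "lower_uniformly_adjusted I M P l'"
  unfolding lower_uniformly_adjusted_def
proof (intro allI impI)
  fix \<eta> :: real and J x
  assume J: "\<eta> > 0" "J \<subseteq> I" "infinite J" "\<forall>n\<in>J. x n \<in> M n \<and> norm (x n) = 1"
  obtain J' y z where *: "J' \<subseteq> J" "infinite J'" "\<forall>n\<in>J'. y n \<in> P n"
      "Limsup (along J') (\<lambda>n. ereal (norm (x n - y n - z))) \<le> ereal (l + \<eta>)"
    using lower_uniformly_adjustedD[OF assms(1) J] by blast
  have "ereal (l + \<eta>) \<le> ereal (l' + \<eta>)" using assms(2) by simp
  then have "Limsup (along J') (\<lambda>n. ereal (norm (x n - y n - z))) \<le> ereal (l' + \<eta>)"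
    using *(4) order_trans by blast
  then show "\<exists>I''\<subseteq>J. infinite I'' \<and> (\<exists>y z. (\<forall>n\<in>I''. y n \<in> P n) \<and>
      Limsup (along I'') (\<lambda>n. ereal (norm (x n - y n - z))) \<le> ereal (l' + \<eta>))"
    using * by blast
qed

text \<open>The slack r - l pays for \<eta> and for replacing the upper limit by a strict inequality
  on a smaller infinite index set.\<close>

lemma lower_uniformly_adjusted_obtain:
  assumes "lower_uniformly_adjusted I M P l" "l < r" "J \<subseteq> I" "infinite J"
    and "\<forall>n\<in>J. x n \<in> M n \<and> norm (x n) = 1"
  obtains J' y z where "J' \<subseteq> J" "infinite J'"
    "\<forall>n\<in>J'. y n \<in> P n" "\<forall>n\<in>J'. norm (x n - y n - z) < r"
proof -
  have "(r - l) / 2 > 0" using assms(2) by simp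
  then obtain J' y z where J': "J' \<subseteq> J" "infinite J'" "\<forall>n\<in>J'. y n \<in> P n"
      "Limsup (along J') (\<lambda>n. ereal (norm (x n - y n - z))) \<le> ereal (l + (r - l) / 2)"
    using lower_uniformly_adjustedD[OF assms(1) _ assms(3,4), of "(r - l) / 2" x] assms(5) by blast
  note J'(4)
  also have "ereal (l + (r - l) / 2) < ereal r" using assms(2) by (simp add: field_simps)
  finally have "\<forall>\<^sub>F n in along J'. norm (x n - y n - z) < r"
    by (drule_tac Limsup_lessD) simp
  then have "infinite {n\<in>J'. norm (x n - y n - z) < r}"
    by (rule infinite_eventually_along[OF J'(2)])
  then show ?thesis using J' by (intro that[of "{n\<in>J'. norm (x n - y n - z) < r}" y z]) auto
qed

text \<open>The choice y = 0, z = 0 serves all unit vectors. It makes the sets of admissible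
  constants nonempty, so that their infima can be approximated.\<close>

lemma lower_uniformly_adjusted_1:
  assumes "\<And>n. n \<in> I \<Longrightarrow> 0 \<in> P n"
  shows "lower_uniformly_adjusted I M P 1"
  unfolding lower_uniformly_adjusted_def
proof (intro allI impI)
  fix \<eta> :: real and J x
  assume *: "\<eta> > 0" "J \<subseteq> I" "infinite J" "\<forall>n\<in>J. x n \<in> M n \<and> norm (x n) = 1"
  have "\<forall>\<^sub>F n in along J. ereal (norm (x n - 0 - 0)) \<le> ereal (1 + \<eta>)"
    using * by (auto simp: eventually_along)
  then have "Limsup (along J) (\<lambda>n. ereal (norm (x n - 0 - 0))) \<le> ereal (1 + \<eta>)"
    by (rule Limsup_bounded)
  then show "\<exists>I''\<subseteq>J. infinite I'' \<and> (\<exists>y z. (\<forall>n\<in>I''. y n \<in> P n) \<and>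
      Limsup (along I'') (\<lambda>n. ereal (norm (x n - y n - z))) \<le> ereal (1 + \<eta>))"
    using * assms by (intro exI[of _ J] conjI order_refl exI[of _ "\<lambda>_. 0"] exI[of _ 0]) auto
qed

lemma unif_adj_le:
  assumes "0 \<le> l" "lower_uniformly_adjusted I M P l"
  shows "unif_adj I M P \<le> l"
  unfolding unif_adj_def using assms by (intro cInf_lower bdd_belowI[of _ 0]) auto

lemma lower_uniformly_adjusted_if_unif_adj_less:
  assumes "\<And>n. n \<in> I \<Longrightarrow> 0 \<in> P n" "unif_adj I M P < l"
  shows "lower_uniformly_adjusted I M P l"
proof -
  have "1 \<in> {l. l \<ge> 0 \<and> lower_uniformly_adjusted I M P l}"
    using lower_uniformly_adjusted_1[OF assms(1)] by simp
  then obtain l0 where "lower_uniformly_adjusted I M P l0" "l0 < l"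
    using cInf_lessD[OF _ assms(2)[unfolded unif_adj_def]] by blast
  then show ?thesis using lower_uniformly_adjusted_mono by fastforce
qed

context banach_scaling
begin

section \<open>Incompatibility of the two adjustments\<close>

text \<open>Z is not compact, but only a ball of Z matters, and finitely many translates of that
  ball form a compact set; a subspace of large dimension has a unit vector far from it.\<close>

lemma separated_selection:
  assumes Z: "edim smul Z < \<infinity>" "subspace Z" and c: "c < 1 / 2" and I: "infinite I"
    and L: "\<And>n. n \<in> I \<Longrightarrow> subspace (L n)"
    and dim: "\<And>p. \<forall>\<^sub>F n in along I. enat p < edim smul (L n)"
  shows "\<exists>r x. strict_mono (r :: nat \<Rightarrow> nat) \<and> (\<forall>k. r k \<in> I \<and> x k \<in> L (r k) \<and> norm (x k) = 1) \<and>
    (\<forall>i j. i < j \<longrightarrow> (\<forall>t\<in>Z. c \<le> norm (x j - x i - t)))"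
proof -
  obtain B where B: "B \<subseteq> Z" "Z \<subseteq> span B" "finite B"
    by (rule edim_finite_obtain_basis[OF Z(1)])
  then have ZB: "Z = span B" using span_minimal[OF B(1) Z(2)] by blast
  have step: "\<exists>n x. m < n \<and> n \<in> I \<and> x \<in> L n \<and> norm x = 1 \<and> (\<forall>a\<in>A. \<forall>t\<in>Z. c \<le> norm (x - a - t))"
    if A: "finite A" "\<And>a. a \<in> A \<Longrightarrow> norm a = 1" for A m
  proof -
    \<comment> \<open>Radius 3: the vectors a are unit vectors, so norm (x - a) \<le> 2, and any t
      of norm above 3 is more than 1 away from x - a.\<close>
    have "compact ((\<lambda>p. fst p + snd p) ` (A \<times> (Z \<inter> cball 0 3)))"
      unfolding ZB using A(1) B(3)
      by (intro compact_continuous_image continuous_intros compact_Times finite_imp_compact compact_span_Int_cball)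
    then obtain p where p: "\<And>L. subspace L \<Longrightarrow> enat p < edim smul L \<Longrightarrow>
        \<exists>x\<in>L. norm x = 1 \<and> (\<forall>q\<in>(\<lambda>p. fst p + snd p) ` (A \<times> (Z \<inter> cball 0 3)). c \<le> norm (x - q))"
      using unit_vector_far_from_compact[OF _ c] by blast
    obtain k where k: "\<forall>n\<in>I. n \<ge> k \<longrightarrow> enat p < edim smul (L n)"
      using dim[of p] by (auto simp: eventually_along)
    obtain n where n: "n \<in> I" "n > max m k"
      using I unfolding infinite_nat_iff_unbounded by blast
    then obtain x where x: "x \<in> L n" "norm x = 1"
        "\<forall>q\<in>(\<lambda>p. fst p + snd p) ` (A \<times> (Z \<inter> cball 0 3)). c \<le> norm (x - q)"
      using p[of "L n"] k L by auto
    have "c \<le> norm (x - a - t)" if at: "a \<in> A" "t \<in> Z" for a t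
    proof (cases "norm t \<le> 3")
      case True
      then have "a + t \<in> (\<lambda>p. fst p + snd p) ` (A \<times> (Z \<inter> cball 0 3))"
        using at by (intro image_eqI[of _ _ "(a, t)"]) auto
      then have "c \<le> norm (x - (a + t))" using x(3) by blast
      then show ?thesis by (simp add: diff_diff_eq)
    next
      case False
      have "norm t \<le> norm (x - a) + norm (x - a - t)"
        using norm_triangle_ineq4[of "x - a" "x - a - t"] by simp
      then show ?thesis
        using False norm_triangle_ineq4[of x a] x(2) A(2)[OF at(1)] c by simp
    qed
    then show ?thesis using n x by auto
  qed
  \<comment> \<open>The third component collects all vectors chosen so far, so that each step
    separates from the whole past.\<close>
  define P where "P s \<longleftrightarrow> (case s of (n, x, A) \<Rightarrow>
      n \<in> I \<and> x \<in> L n \<and> norm x = 1 \<and> finite A \<and> (\<forall>a\<in>A. norm a = 1) \<and> x \<in> A)"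
    for s :: "nat \<times> 'a \<times> 'a set"
  define Q where "Q s s' \<longleftrightarrow> (case s of (n, x, A) \<Rightarrow> case s' of (n', x', A') \<Rightarrow>
      n < n' \<and> A \<subseteq> A' \<and> (\<forall>a\<in>A. \<forall>t\<in>Z. c \<le> norm (x' - a - t)))"
    for s s' :: "nat \<times> 'a \<times> 'a set"
  have "\<exists>s. \<forall>k. P (s k) \<and> Q (s k) (s (Suc k))"
  proof (rule dependent_nat_choice)
    obtain n x where "n \<in> I" "x \<in> L n" "norm x = 1" using step[of "{}" 0] by auto
    then have "P (n, x, {x})" by (simp add: P_def)
    then show "\<exists>s. P s" by blast
  next
    fix s k assume "P s"
    then obtain n x A where s: "s = (n, x, A)" and A: "finite A" "\<And>a. a \<in> A \<Longrightarrow> norm a = 1"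
      by (auto simp: P_def)
    obtain n' x' where "n < n'" "n' \<in> I" "x' \<in> L n'" "norm x' = 1"
        "\<forall>a\<in>A. \<forall>t\<in>Z. c \<le> norm (x' - a - t)"
      using step[OF A, of n] by blast
    then have "P (n', x', insert x' A)" "Q s (n', x', insert x' A)"
      using A by (auto simp: P_def Q_def s)
    then show "\<exists>s'. P s' \<and> Q s s'" by blast
  qed
  then obtain s where s: "\<And>k. P (s k)" "\<And>k. Q (s k) (s (Suc k))" by blast
  define r where "r k = fst (s k)" for k
  define x where "x k = fst (snd (s k))" for k
  define A where "A k = snd (snd (s k))" for k
  have s_eq: "s k = (r k, x k, A k)" for k by (simp add: r_def x_def A_def)
  have P: "r k \<in> I" "x k \<in> L (r k)" "norm (x k) = 1" "x k \<in> A k" for k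
    using s(1)[of k] by (auto simp: s_eq P_def)
  have Q: "r k < r (Suc k)" "A k \<subseteq> A (Suc k)" "\<And>a t. a \<in> A k \<Longrightarrow> t \<in> Z \<Longrightarrow> c \<le> norm (x (Suc k) - a - t)" for k
    using s(2)[of k] by (auto simp: s_eq Q_def)
  have "A i \<subseteq> A j" if "i \<le> j" for i j
    using that Q(2) by (rule lift_Suc_mono_le[rotated])
  then have "x i \<in> A j" if "i \<le> j" for i j using that P(4) by blast
  then have "c \<le> norm (x j - x i - t)" if "i < j" "t \<in> Z" for i j t
    using that Q(3)[of "x i" "j - 1" t] by (cases j) auto
  moreover have "strict_mono r" using Q(1) by (simp add: strict_mono_Suc_iff)
  ultimately show ?thesis using P(1-3) by (intro exI[of _ r] exI[of _ x]) blast
qed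

text \<open>One e is spent on passing to y, the other on normalizing it; e < 1 keeps y
  nonzero.\<close>

lemma close_unit_vector:
  assumes L: "subspace L'" and x: "norm x = 1" and y: "y \<in> L'" "norm (x - y) \<le> e" "e < 1"
  obtains u where "u \<in> L'" "norm u = 1" "norm (x - u) \<le> 2 * e"
proof
  have le: "\<bar>1 - norm y\<bar> \<le> e"
    using norm_triangle_ineq3[of x y] x y(2) by linarith
  then have pos: "norm y > 0" using y(3) by linarith
  define u where "u = smul (of_real (1 / norm y)) y"
  show "u \<in> L'" unfolding u_def using y(1) by (intro subspace_scale L)
  show "norm u = 1" using pos unfolding u_def norm_smul norm_of_real by simp
  have "y - u = (1 - 1 / norm y) *\<^sub>R y" unfolding u_def smul_of_real by (simp add: scaleR_diff_left)
  then have "norm (y - u) = \<bar>1 - 1 / norm y\<bar> * norm y" by simp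
  also have "\<dots> = \<bar>(1 - 1 / norm y) * norm y\<bar>" by (simp only: abs_mult abs_norm_cancel)
  also have "(1 - 1 / norm y) * norm y = norm y - 1" using pos by (simp add: field_simps)
  finally have "norm (y - u) \<le> e" using le by linarith
  then show "norm (x - u) \<le> 2 * e"
    using norm_triangle_ineq[of "x - y" "y - u"] y(2) by simp
qed

text \<open>Differences of a well separated sequence of unit vectors of the \<open>L n\<close> come too close to
  \<open>M \<inter> N\<close>: along a subsequence they are \<open>2a\<close>-close to \<open>M\<close> and \<open>2b\<close>-close to \<open>N\<close>,
  because the vectors \<open>z\<close> of the two adjustments cancel.\<close>

lemma not_both_adjusted:
  assumes M: "subspace M" and N: "subspace N" and fin: "edim smul (M \<inter> N) < \<infinity>" and q0: "0 \<le> q"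
    and q: "\<And>w. w \<in> M + N \<Longrightarrow> \<exists>u\<in>M. \<exists>t\<in>M \<inter> N. \<exists>v\<in>N. w = u + t + v \<and> norm u \<le> q * norm w \<and> norm v \<le> q * norm w"
    and I: "infinite I"
    and L: "\<And>n. n \<in> I \<Longrightarrow> subspace (L n)" and L': "\<And>n. n \<in> I \<Longrightarrow> subspace (L' n)"
    and dim: "\<And>p. \<forall>\<^sub>F n in along I. enat p < edim smul (L n)"
    and near: "\<And>n x. n \<in> I \<Longrightarrow> x \<in> L n \<Longrightarrow> \<exists>y\<in>L' n. norm (x - y) \<le> \<epsilon> n * norm x"
    and eps: "\<epsilon> \<longlonglongrightarrow> 0"
    and adj: "lower_uniformly_adjusted I L (\<lambda>_. M) a" "lower_uniformly_adjusted I L' (\<lambda>_. N) b"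
  shows "1 / 2 \<le> 2 * (min a b + q * (a + b))"
proof (rule ccontr)
  assume "\<not> ?thesis"
  then have less: "2 * (min a b + q * (a + b)) < 1 / 2" by simp
  \<comment> \<open>Enlarging a and b by d raises the bound by 2 (1 + 2 q) d, which is half the gap
    to 1 / 2.\<close>
  define d where "d = (1 / 2 - 2 * (min a b + q * (a + b))) / (4 * (1 + 2 * q))"
  have d: "d > 0" unfolding d_def using less q0 by (intro divide_pos_pos) auto
  define a' where "a' = a + d"
  define b' where "b' = b + d"
  define c where "c = 2 * (min a' b' + q * (a' + b'))"
  have "d * (4 * (1 + 2 * q)) = 1 / 2 - 2 * (min a b + q * (a + b))"
    unfolding d_def using q0 by simp
  moreover have "c = 2 * (min a b + q * (a + b)) + d * (2 * (1 + 2 * q))"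
    by (simp add: c_def a'_def b'_def min_add_distrib_left algebra_simps flip: min_add_distrib_left)
  ultimately have c: "c < 1 / 2" using less by linarith
  have Z: "subspace (M \<inter> N)" by (rule subspace_inter[OF M N])
  have "\<exists>r x. strict_mono (r :: nat \<Rightarrow> nat) \<and> (\<forall>k. r k \<in> I \<and> x k \<in> L (r k) \<and> norm (x k) = 1) \<and>
      (\<forall>i j. i < j \<longrightarrow> (\<forall>t\<in>M \<inter> N. c \<le> norm (x j - x i - t)))"
    by (rule separated_selection[OF fin Z c I L dim])
  then obtain r x
    where r: "strict_mono (r :: nat \<Rightarrow> nat)"
      and rx: "\<forall>k. r k \<in> I \<and> x k \<in> L (r k) \<and> norm (x k) = 1"
      and "\<forall>i j. i < j \<longrightarrow> (\<forall>t\<in>M \<inter> N. c \<le> norm (x j - x i - t))"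
    by (elim exE conjE)
  then have far: "\<forall>t\<in>M \<inter> N. c \<le> norm (x j - x i - t)" if "i < j" for i j
    using that by blast
  have inj: "inj r" using r by (rule strict_mono_imp_inj_on)
  \<comment> \<open>The adjustments speak of sequences indexed by subsets of I, so the selected
    vectors are reindexed by n = r k.\<close>
  define X where "X n = x (inv r n)" for n
  have X_r: "X (r k) = x k" for k using inj by (simp add: X_def)
  have X: "\<forall>n\<in>range r. X n \<in> L n \<and> norm (X n) = 1"
    using rx by (auto simp: X_r)
  have rI: "range r \<subseteq> I" "infinite (range r)" using rx inj range_inj_infinite by auto
  have "a < a'" using d by (simp add: a'_def)
  obtain J y z where J: "J \<subseteq> range r" "infinite J" and y: "\<forall>n\<in>J. y n \<in> M"
      "\<forall>n\<in>J. norm (X n - y n - z) < a'"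
    by (rule lower_uniformly_adjusted_obtain[OF adj(1) \<open>a < a'\<close> rI X])
  \<comment> \<open>Replacing \<open>X n\<close> by a unit vector \<open>U n\<close> of
    \<open>L' n\<close> costs at most 2 e \<le> d / 2, so an adjustment of U within b + d / 2 is one
    of X within \<open>b'\<close>.\<close>
  define e where "e = min (1 / 2) (d / 4)"
  have e: "e > 0" "e < 1" "2 * e \<le> d / 2" using d by (auto simp: e_def)
  have "\<forall>\<^sub>F n in sequentially. \<epsilon> n < e" using eps e(1) by (rule order_tendstoD)
  then have "\<forall>\<^sub>F n in along J. \<epsilon> n < e" by (auto simp: eventually_along eventually_sequentially)
  then have J1: "infinite {n\<in>J. \<epsilon> n < e}" by (rule infinite_eventually_along[OF J(2)])
  have "\<exists>u. u \<in> L' n \<and> norm u = 1 \<and> norm (X n - u) \<le> 2 * e" if n: "n \<in> {n\<in>J. \<epsilon> n < e}" for n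
  proof -
    have nI: "n \<in> I" "n \<in> range r" using n J(1) rI by auto
    obtain h where h: "h \<in> L' n" "norm (X n - h) \<le> \<epsilon> n * norm (X n)"
      using near[OF nI(1)] bspec[OF X nI(2)] by blast
    then have "norm (X n - h) \<le> e" using n bspec[OF X nI(2)] by simp
    from close_unit_vector[OF L'[OF nI(1)] conjunct2[OF bspec[OF X nI(2)]] h(1) this e(2)]
    show ?thesis by blast
  qed
  then obtain U where U: "\<forall>n\<in>{n\<in>J. \<epsilon> n < e}. U n \<in> L' n \<and> norm (U n) = 1"
      "\<And>n. n \<in> {n\<in>J. \<epsilon> n < e} \<Longrightarrow> norm (X n - U n) \<le> 2 * e"
    by metis
  have bd: "b < b + d / 2" using d by simp
  have JI: "{n\<in>J. \<epsilon> n < e} \<subseteq> I" using J(1) rI by auto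
  obtain J' w z' where J': "J' \<subseteq> {n\<in>J. \<epsilon> n < e}" "infinite J'"
      and w: "\<forall>n\<in>J'. w n \<in> N" "\<forall>n\<in>J'. norm (U n - w n - z') < b + d / 2"
    by (rule lower_uniformly_adjusted_obtain[OF adj(2) bd JI J1 U(1)])
  have w': "norm (X n - w n - z') < b'" if "n \<in> J'" for n
  proof -
    have "X n - w n - z' = (X n - U n) + (U n - w n - z')" by simp
    then have "norm (X n - w n - z') \<le> norm (X n - U n) + norm (U n - w n - z')"
      by (metis norm_triangle_ineq)
    then show ?thesis using bspec[OF w(2) that] U(2)[of n] that J'(1) e(3) by (force simp: b'_def)
  qed
  obtain m where m: "m \<in> J'" using J'(2) by fastforce
  obtain n where n: "n \<in> J'" "m < n" using J'(2) unfolding infinite_nat_iff_unbounded by blast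
  have mJ: "m \<in> J" "n \<in> J" using m n J'(1) by auto
  then obtain i j where ij: "m = r i" "n = r j" using J(1) by blast
  then have "i < j" using n(2) strict_mono_less[OF r] by simp
  have diff: "norm ((A - C) - (A' - C')) < s + s" if "norm (A - A' - E) < s" "norm (C - C' - E) < s"
    for A C A' C' E :: 'a and s
    using that norm_triangle_ineq4[of "A - A' - E" "C - C' - E"] by (simp add: algebra_simps)
  define D where "D = x j - x i"
  define yy where "yy = y n - y m"
  define ww where "ww = w n - w m"
  have Dy: "norm (D - yy) < a' + a'"
    using diff[OF bspec[OF y(2) mJ(2)] bspec[OF y(2) mJ(1)]] by (simp add: D_def yy_def ij X_r)
  have Dw: "norm (D - ww) < b' + b'"
    using diff[OF w'[OF n(1)] w'[OF m]] by (simp add: D_def ww_def ij X_r)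
  have yyM: "yy \<in> M" unfolding yy_def using y(1) mJ by (intro subspace_diff M) auto
  have wwN: "ww \<in> N" unfolding ww_def using w(1) m n by (intro subspace_diff N) auto
  have "yy + - ww \<in> M + N" using yyM wwN by (intro set_plus_intro subspace_neg N)
  then obtain u t v where utv: "u \<in> M" "t \<in> M \<inter> N" "v \<in> N" "yy - ww = u + t + v"
      "norm u \<le> q * norm (yy - ww)" "norm v \<le> q * norm (yy - ww)"
    using q[of "yy - ww"] by auto
  have "norm (yy - ww) \<le> norm (D - ww) + norm (D - yy)"
    using norm_triangle_ineq4[of "D - ww" "D - yy"] by simp
  then have "q * norm (yy - ww) \<le> q * ((a' + b') + (a' + b'))"
    using Dy Dw q0 by (intro mult_left_mono) auto
  then have uv: "norm u \<le> 2 * (q * (a' + b'))" "norm v \<le> 2 * (q * (a' + b'))"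
    using utv(5,6) by (auto simp: algebra_simps)
  \<comment> \<open>The left side lies in M, the right side in N. So \<open>ww + v\<close> and
    \<open>ww + v + t\<close> are points of \<open>M \<inter> N\<close>, the first at distance norm
    v from \<open>ww\<close>, the second at distance norm u from \<open>yy\<close>. Comparing D with
    each yields the two terms of the minimum.\<close>
  have eq: "yy - u - t = ww + v" using utv(4) by (simp add: algebra_simps)
  have "yy - u - t \<in> M" using utv yyM by (intro subspace_diff M) auto
  moreover have "ww + v \<in> N" using utv wwN by (intro subspace_add N) auto
  ultimately have s: "ww + v \<in> M \<inter> N" using eq by simp
  have "c \<le> norm (D - (ww + v + t))"
    unfolding D_def by (rule bspec[OF far[OF \<open>i < j\<close>] subspace_add[OF Z s utv(2)]])
  also have "D - (ww + v + t) = (D - yy) + u" using eq by (simp add: algebra_simps)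
  also have "norm \<dots> < a' + a' + 2 * (q * (a' + b'))"
    using norm_triangle_ineq[of "D - yy" u] Dy uv(1) by linarith
  finally have 1: "c < 2 * (a' + q * (a' + b'))" by (simp add: algebra_simps)
  have "c \<le> norm (D - (ww + v))"
    unfolding D_def by (rule bspec[OF far[OF \<open>i < j\<close>] s])
  also have "D - (ww + v) = (D - ww) - v" by simp
  also have "norm \<dots> < b' + b' + 2 * (q * (a' + b'))"
    using norm_triangle_ineq4[of "D - ww" v] Dw uv(2) by linarith
  finally have "c < 2 * (b' + q * (a' + b'))" by (simp add: algebra_simps)
  then show False using 1 by (auto simp: c_def min_def split: if_splits)
qed

end

section \<open>Perturbation of lower semi-Fredholm pairs\<close>

lemma enat_tendsto_infinity_iff:
  fixes f :: "nat \<Rightarrow> enat"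
  shows "(f \<longlongrightarrow> \<infinity>) F \<longleftrightarrow> (\<forall>p. \<forall>\<^sub>F n in F. enat p < f n)"
proof
  assume "(f \<longlongrightarrow> \<infinity>) F"
  then show "\<forall>p. \<forall>\<^sub>F n in F. enat p < f n"
    by (auto intro: order_tendstoD)
next
  assume *: "\<forall>p. \<forall>\<^sub>F n in F. enat p < f n"
  show "(f \<longlongrightarrow> \<infinity>) F"
  proof (rule order_tendstoI)
    fix a :: enat assume "a < \<infinity>"
    then obtain p where "a = enat p" by (cases a) auto
    then show "\<forall>\<^sub>F n in F. a < f n" using * by simp
  qed simp
qed

context banach_scaling
begin

lemma edim_singleton_0: "edim smul {0} = enat 0"
proof -
  have "edim smul {0} = enat (dim {0})" by (auto simp: edim_def intro!: exI[of _ "{}"])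
  moreover have "dim {0} \<le> card ({} :: 'a set)" by (rule dim_le_card) auto
  ultimately show ?thesis by simp
qed

section \<open>Adjusted subspaces inside near graphs\<close>

text \<open>The admissible constants include 1, so some admissible constant lies strictly below l.
  Positivity of l is recorded because later the factor of a + b is enlarged.\<close>

lemma fss_unif_adj_obtain:
  assumes less: "fss_unif_adj smul I M (\<lambda>_. P) < l" and P: "0 \<in> P"
    and I': "I' \<subseteq> I" "infinite I'"
    and K: "\<forall>n\<in>I'. subspace (K n) \<and> K n \<subseteq> M n \<and> edim smul (K n) < \<infinity>"
    and dim: "\<And>p. \<forall>\<^sub>F n in along I'. enat p < edim smul (K n)"
  obtains I'' L where "I'' \<subseteq> I'" "infinite I''" "\<forall>n\<in>I''. subspace (L n) \<and> L n \<subseteq> K n"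
    "\<forall>p. \<forall>\<^sub>F n in along I''. enat p < edim smul (L n)" "lower_uniformly_adjusted I'' L (\<lambda>_. P) l" "0 < l"
proof -
  define Prop where "Prop l \<longleftrightarrow> (\<forall>I'\<subseteq>I. infinite I' \<longrightarrow>
       (\<forall>K. (\<forall>n\<in>I'. subspace (K n) \<and> K n \<subseteq> M n \<and> edim smul (K n) < \<infinity>) \<and>
            ((\<lambda>n. edim smul (K n)) \<longlongrightarrow> \<infinity>) (along I') \<longrightarrow>
         (\<exists>I''\<subseteq>I'. infinite I'' \<and>
           (\<exists>L. (\<forall>n\<in>I''. subspace (L n) \<and> L n \<noteq> {0} \<and> L n \<subseteq> K n) \<and>
             ((\<lambda>n. edim smul (L n)) \<longlongrightarrow> \<infinity>) (along I'') \<and>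
             unif_adj I'' L (\<lambda>_. P) \<le> l))))" for l
  have "Prop 1"
    unfolding Prop_def
  proof (intro allI impI, elim conjE)
    fix J and K :: "nat \<Rightarrow> 'a set"
    assume J: "J \<subseteq> I" "infinite J" and K: "\<forall>n\<in>J. subspace (K n) \<and> K n \<subseteq> M n \<and> edim smul (K n) < \<infinity>"
      and lim: "((\<lambda>n. edim smul (K n)) \<longlongrightarrow> \<infinity>) (along J)"
    have "\<forall>\<^sub>F n in along J. enat 0 < edim smul (K n)"
      using lim by (simp add: enat_tendsto_infinity_iff)
    \<comment> \<open>The subspaces \<open>L n\<close> must be nonzero, so the indices with
      \<open>K n\<close> of dimension 0 are dropped.\<close>
    then have inf: "infinite {n\<in>J. enat 0 < edim smul (K n)}" (is "infinite ?J'")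
      by (rule infinite_eventually_along[OF J(2)])
    have "((\<lambda>n. edim smul (K n)) \<longlongrightarrow> \<infinity>) (along ?J')"
      by (rule tendsto_mono[OF along_mono lim]) auto
    moreover have "unif_adj ?J' K (\<lambda>_. P) \<le> 1"
      using P by (intro unif_adj_le lower_uniformly_adjusted_1) auto
    moreover have "\<forall>n\<in>?J'. subspace (K n) \<and> K n \<noteq> {0} \<and> K n \<subseteq> K n"
    proof
      fix n assume n: "n \<in> ?J'"
      then have "K n \<noteq> {0}" by (metis (mono_tags, lifting) edim_singleton_0 less_irrefl mem_Collect_eq)
      then show "subspace (K n) \<and> K n \<noteq> {0} \<and> K n \<subseteq> K n" using K n by blast
    qed
    moreover have "?J' \<subseteq> J" by blast
    ultimately show "\<exists>J'\<subseteq>J. infinite J' \<and> (\<exists>L. (\<forall>n\<in>J'. subspace (L n) \<and> L n \<noteq> {0} \<and> L n \<subseteq> K n) \<and>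
        ((\<lambda>n. edim smul (L n)) \<longlongrightarrow> \<infinity>) (along J') \<and> unif_adj J' L (\<lambda>_. P) \<le> 1)"
      using inf by (intro exI[of _ ?J'] conjI exI[of _ K])
  qed
  then have "1 \<in> {l. l \<ge> 0 \<and> Prop l}" by simp
  moreover have "Inf {l. l \<ge> 0 \<and> Prop l} < l" using less unfolding fss_unif_adj_def Prop_def .
  ultimately obtain l0 where "Prop l0" "0 \<le> l0" "l0 < l"
    using cInf_lessD[of "{l. l \<ge> 0 \<and> Prop l}" l] by blast
  have "((\<lambda>n. edim smul (K n)) \<longlongrightarrow> \<infinity>) (along I')"
    using dim by (simp add: enat_tendsto_infinity_iff)
  from \<open>Prop l0\<close>[unfolded Prop_def, THEN spec, THEN mp, OF I'(1), THEN mp, OF I'(2), THEN spec, THEN mp,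
      OF conjI[OF K this]]
  obtain I'' L where *: "I'' \<subseteq> I'" "infinite I''" "\<forall>n\<in>I''. subspace (L n) \<and> L n \<noteq> {0} \<and> L n \<subseteq> K n"
      "((\<lambda>n. edim smul (L n)) \<longlongrightarrow> \<infinity>) (along I'')" "unif_adj I'' L (\<lambda>_. P) \<le> l0"
    by (elim exE conjE)
  have "lower_uniformly_adjusted I'' L (\<lambda>_. P) l"
    using *(5) \<open>l0 < l\<close> P by (intro lower_uniformly_adjusted_if_unif_adj_less) auto
  then show ?thesis
    using * \<open>0 \<le> l0\<close> \<open>l0 < l\<close> by (intro that[of I'' L]) (auto simp: enat_tendsto_infinity_iff)
qed

lemma ss_unif_adj_obtain:
  assumes less: "ss_unif_adj smul I M (\<lambda>_. P) < l" and P: "0 \<in> P"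
    and I': "I' \<subseteq> I" "infinite I'"
    and K: "\<forall>n\<in>I'. closed_subspace smul (K n) \<and> K n \<subseteq> M n \<and> edim smul (K n) = \<infinity>"
  obtains I'' L where "I'' \<subseteq> I'" "infinite I''"
    "\<forall>n\<in>I''. closed_subspace smul (L n) \<and> L n \<subseteq> K n \<and> edim smul (L n) = \<infinity>"
    "lower_uniformly_adjusted I'' L (\<lambda>_. P) l" "0 < l"
proof -
  define Prop where "Prop l \<longleftrightarrow> (\<forall>I'\<subseteq>I. infinite I' \<longrightarrow>
       (\<forall>K. (\<forall>n\<in>I'. closed_subspace smul (K n) \<and> K n \<subseteq> M n \<and> edim smul (K n) = \<infinity>) \<longrightarrow>
         (\<exists>I''\<subseteq>I'. infinite I'' \<and>
           (\<exists>L. (\<forall>n\<in>I''. closed_subspace smul (L n) \<and> L n \<subseteq> K n \<and> edim smul (L n) = \<infinity>) \<and>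
             unif_adj I'' L (\<lambda>_. P) \<le> l))))" for l
  have "Prop 1"
    unfolding Prop_def
  proof (intro allI impI)
    fix J and K :: "nat \<Rightarrow> 'a set"
    assume "J \<subseteq> I" "infinite J" "\<forall>n\<in>J. closed_subspace smul (K n) \<and> K n \<subseteq> M n \<and> edim smul (K n) = \<infinity>"
    moreover have "unif_adj J K (\<lambda>_. P) \<le> 1"
      using P by (intro unif_adj_le lower_uniformly_adjusted_1) auto
    ultimately show "\<exists>J'\<subseteq>J. infinite J' \<and> (\<exists>L. (\<forall>n\<in>J'. closed_subspace smul (L n) \<and> L n \<subseteq> K n \<and>
        edim smul (L n) = \<infinity>) \<and> unif_adj J' L (\<lambda>_. P) \<le> 1)"
      by (intro exI[of _ J] conjI exI[of _ K]) auto
  qed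
  then have "1 \<in> {l. l \<ge> 0 \<and> Prop l}" by simp
  moreover have "Inf {l. l \<ge> 0 \<and> Prop l} < l" using less unfolding ss_unif_adj_def Prop_def .
  ultimately obtain l0 where "Prop l0" "0 \<le> l0" "l0 < l"
    using cInf_lessD[of "{l. l \<ge> 0 \<and> Prop l}" l] by blast
  from \<open>Prop l0\<close>[unfolded Prop_def, THEN spec, THEN mp, OF I'(1), THEN mp, OF I'(2), THEN spec, THEN mp, OF K]
  obtain I'' L where *: "I'' \<subseteq> I'" "infinite I''"
      "\<forall>n\<in>I''. closed_subspace smul (L n) \<and> L n \<subseteq> K n \<and> edim smul (L n) = \<infinity>"
      "unif_adj I'' L (\<lambda>_. P) \<le> l0"
    by (elim exE conjE)
  have "lower_uniformly_adjusted I'' L (\<lambda>_. P) l"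
    using *(4) \<open>l0 < l\<close> P by (intro lower_uniformly_adjusted_if_unif_adj_less) auto
  then show ?thesis using * \<open>0 \<le> l0\<close> \<open>l0 < l\<close> by (intro that[of I'' L]) auto
qed

lemma near_graph_converse_Image_subset:
  assumes G: "near_graph e G" and L': "L' \<subseteq> G `` L"
  shows "G\<inverse> `` L' \<subseteq> L"
proof
  fix x assume "x \<in> G\<inverse> `` L'"
  then obtain y where y: "(x, y) \<in> G" "y \<in> L'" by blast
  then obtain x' where x': "x' \<in> L" "(x', y) \<in> G" using L' by blast
  have "(x - x', 0) \<in> G" using near_graph_diff[OF G y(1) x'(2)] by simp
  from near_graphD(6)[OF G this] show "x \<in> L" using x'(1) by simp
qed

text \<open>The subspace \<open>L' n\<close> of the image is pulled back into \<open>L n\<close>: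
  the preimage inherits the adjustment with M, keeps the dimension, and its vectors are relatively
  \<epsilon>-close to \<open>L' n\<close>.\<close>

lemma near_graph_not_both_adjusted:
  assumes M: "subspace M" and N: "subspace N" and fin: "edim smul (M \<inter> N) < \<infinity>" and q0: "0 \<le> q"
    and q: "\<And>w. w \<in> M + N \<Longrightarrow> \<exists>u\<in>M. \<exists>t\<in>M \<inter> N. \<exists>v\<in>N. w = u + t + v \<and> norm u \<le> q * norm w \<and> norm v \<le> q * norm w"
    and G: "\<And>n. n \<in> I \<Longrightarrow> near_graph (\<epsilon> n) (G n)" and eps: "\<epsilon> \<longlonglongrightarrow> 0"
    and J: "J \<subseteq> I" "J' \<subseteq> J" "infinite J'"
    and L': "\<And>n. n \<in> J' \<Longrightarrow> subspace (L' n) \<and> L' n \<subseteq> G n `` L n"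
    and dim: "\<And>p. \<forall>\<^sub>F n in along J'. enat p < edim smul (L' n)"
    and adj: "lower_uniformly_adjusted J L (\<lambda>_. M) a" "lower_uniformly_adjusted J' L' (\<lambda>_. N) b"
  shows "1 / 2 \<le> 2 * (min a b + q * (a + b))"
proof (rule not_both_adjusted[OF M N fin q0 q J(3) _ _ _ _ eps _ adj(2)])
  define L'' where "L'' n = (G n)\<inverse> `` L' n" for n
  have G': "near_graph (\<epsilon> n) (G n)" if "n \<in> J'" for n using G J that by blast
  show "subspace (L'' n)" if "n \<in> J'" for n
    unfolding L''_def using L'[OF that]
    by (intro subspace_near_graph_Image[OF near_graph_converse[OF G'[OF that]]]) blast
  show "subspace (L' n)" if "n \<in> J'" for n using L' that by blast
  have le: "edim smul (L' n) \<le> edim smul (L'' n)" if "n \<in> J'" for n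
    unfolding L''_def using L'[OF that]
    by (intro edim_le_near_graph_Image[OF near_graph_converse[OF G'[OF that]]]) blast
  show "\<forall>\<^sub>F n in along J'. enat p < edim smul (L'' n)" for p
    using dim[of p] le unfolding eventually_along by (meson less_le_trans)
  show "\<exists>y\<in>L' n. norm (x - y) \<le> \<epsilon> n * norm x" if "n \<in> J'" "x \<in> L'' n" for n x
    using that near_graphD(5)[OF G'[OF that(1)]] unfolding L''_def by blast
  have "L'' n \<subseteq> L n" if "n \<in> J'" for n
    unfolding L''_def using L' that by (intro near_graph_converse_Image_subset[OF G']) auto
  then show "lower_uniformly_adjusted J' L'' (\<lambda>_. M) a"
    by (intro lower_uniformly_adjusted_antimono[OF adj(1) J(2)])
qed

lemma fss_unif_adj_near_graph:
  assumes lsf: "lower_semi_fredholm smul M N" and phi: "phi smul M N < c"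
    and I: "I' \<subseteq> I" "infinite I'"
    and G: "\<And>n. n \<in> I' \<Longrightarrow> near_graph (\<epsilon> n) (G n) \<and> G n \<subseteq> Mn n \<times> Nn n" and eps: "\<epsilon> \<longlonglongrightarrow> 0"
    and dim: "\<And>p. \<forall>\<^sub>F n in along I'. enat p < edim smul (Domain (G n))"
    and a: "fss_unif_adj smul I Mn (\<lambda>_. M) < a" and b: "fss_unif_adj smul I Nn (\<lambda>_. N) < b"
  shows "1 / 2 \<le> 2 * (min a b + c * (a + b))"
proof -
  have M: "subspace M" and N: "subspace N" and fin: "edim smul (M \<inter> N) < \<infinity>"
    using lsf by (simp_all add: lower_semi_fredholm_def closed_subspace_def lower_defect_def)
  have "\<exists>K. subspace K \<and> K \<subseteq> Domain (G n) \<and> edim smul K = min (edim smul (Domain (G n))) (enat n)"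
    if n: "n \<in> I'" for n
  proof -
    have "min (edim smul (Domain (G n))) (enat n) \<le> enat n" by simp
    then obtain k where k: "min (edim smul (Domain (G n))) (enat n) = enat k" using enat_ile by blast
    then have "enat k \<le> edim smul (Domain (G n))" by (metis min.cobounded1)
    then obtain A where A: "A \<subseteq> Domain (G n)" "independent A" "finite A" "card A = k"
      by (rule independent_subset_of_card)
    have "subspace ((G n)\<inverse> `` UNIV)"
      using G[OF n] by (intro subspace_near_graph_Image near_graph_converse) auto
    also have "(G n)\<inverse> `` UNIV = Domain (G n)" by blast
    finally have "span A \<subseteq> Domain (G n)" using A(1) by (intro span_minimal)
    then show ?thesis using edim_span_independent[OF A(2,3)] A(4) k by (intro exI[of _ "span A"]) simp
  qed
  then obtain K where K: "\<And>n. n \<in> I' \<Longrightarrow> subspace (K n)" "\<And>n. n \<in> I' \<Longrightarrow> K n \<subseteq> Domain (G n)"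
      "\<And>n. n \<in> I' \<Longrightarrow> edim smul (K n) = min (edim smul (Domain (G n))) (enat n)"
    by metis
  have Kn: "\<forall>n\<in>I'. subspace (K n) \<and> K n \<subseteq> Mn n \<and> edim smul (K n) < \<infinity>"
  proof
    fix n assume n: "n \<in> I'"
    have "edim smul (K n) \<le> enat n" unfolding K(3)[OF n] by simp
    also have "\<dots> < \<infinity>" by simp
    finally show "subspace (K n) \<and> K n \<subseteq> Mn n \<and> edim smul (K n) < \<infinity>"
      using K(1,2)[OF n] G[OF n] by blast
  qed
  have Kdim: "\<forall>\<^sub>F n in along I'. enat p < edim smul (K n)" for p
  proof -
    obtain m where "\<forall>n\<in>I'. n \<ge> m \<longrightarrow> enat p < edim smul (Domain (G n))"
      using dim[of p] by (auto simp: eventually_along)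
    then have "\<forall>n\<in>I'. n \<ge> max m (Suc p) \<longrightarrow> enat p < edim smul (K n)"
      by (simp add: K(3))
    then show ?thesis unfolding eventually_along by blast
  qed
  obtain J L where J: "J \<subseteq> I'" "infinite J" and L: "\<forall>n\<in>J. subspace (L n) \<and> L n \<subseteq> K n"
      and Ldim: "\<forall>p. \<forall>\<^sub>F n in along J. enat p < edim smul (L n)" and adjL: "lower_uniformly_adjusted J L (\<lambda>_. M) a" and a0: "0 < a"
    by (rule fss_unif_adj_obtain[OF a subspace_0[OF M] I Kn Kdim])
  have GJ: "near_graph (\<epsilon> n) (G n)" "G n \<subseteq> Mn n \<times> Nn n" if "n \<in> J" for n using G J(1) that by blast+
  have LD: "L n \<subseteq> Domain (G n)" if "n \<in> J" for n using bspec[OF L that] K(2) J(1) that by blast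
  have image: "\<forall>n\<in>J. subspace (G n `` L n) \<and> G n `` L n \<subseteq> Nn n \<and> edim smul (G n `` L n) < \<infinity>"
  proof (intro ballI conjI)
    fix n assume n: "n \<in> J"
    show "subspace (G n `` L n)" using bspec[OF L n] by (intro subspace_near_graph_Image[OF GJ(1)[OF n]]) blast
    show "G n `` L n \<subseteq> Nn n" using GJ(2)[OF n] by blast
    \<comment> \<open>Finite dimension passes to the image because the converse relation is
      injective.\<close>
    have "edim smul (G n `` L n) \<le> edim smul ((G n)\<inverse> `` (G n `` L n))"
      by (intro edim_le_near_graph_Image[OF near_graph_converse[OF GJ(1)[OF n]]]) blast
    also have "\<dots> \<le> edim smul (K n)"
      using near_graph_converse_Image_subset[OF GJ(1)[OF n] order_refl, of "L n"] bspec[OF L n]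
      by (intro edim_mono) blast
    also have "\<dots> < \<infinity>" using Kn J(1) n by blast
    finally show "edim smul (G n `` L n) < \<infinity>" .
  qed
  have imdim: "\<forall>\<^sub>F n in along J. enat p < edim smul (G n `` L n)" for p
    using spec[OF Ldim, of p] edim_le_near_graph_Image[OF GJ(1) LD] unfolding eventually_along by (meson less_le_trans)
  have JI: "J \<subseteq> I" using J I by blast
  obtain J' L' where J': "J' \<subseteq> J" "infinite J'" and L': "\<forall>n\<in>J'. subspace (L' n) \<and> L' n \<subseteq> G n `` L n"
      and L'dim: "\<forall>p. \<forall>\<^sub>F n in along J'. enat p < edim smul (L' n)"
      and adjL': "lower_uniformly_adjusted J' L' (\<lambda>_. N) b" and b0: "0 < b"
    by (rule fss_unif_adj_obtain[OF b subspace_0[OF N] JI J(2) image imdim])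
  obtain q where q0: "0 \<le> q" "q < c"
      and q: "\<forall>w\<in>M + N. \<exists>u\<in>M. \<exists>t\<in>M \<inter> N. \<exists>v\<in>N. w = u + t + v \<and> norm u \<le> q * norm w \<and> norm v \<le> q * norm w"
    by (rule phi_approx[OF lsf phi])
  have "1 / 2 \<le> 2 * (min a b + q * (a + b))"
    by (rule near_graph_not_both_adjusted[OF M N fin q0(1) bspec[OF q] GJ(1) eps order_refl J' bspec[OF L'] spec[OF L'dim] adjL adjL'])
  moreover have "q * (a + b) \<le> c * (a + b)"
    using q0(2) a0 b0 by (intro mult_right_mono) auto
  ultimately show ?thesis by simp
qed

lemma ss_unif_adj_near_graph:
  assumes lsf: "lower_semi_fredholm smul M N" and phi: "phi smul M N < c"
    and I: "I' \<subseteq> I" "infinite I'"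
    and G: "\<And>n. n \<in> I' \<Longrightarrow> near_graph (\<epsilon> n) (G n) \<and> G n \<subseteq> Mn n \<times> Nn n \<and> edim smul (Domain (G n)) = \<infinity>"
    and eps: "\<epsilon> \<longlonglongrightarrow> 0" "\<And>n. \<epsilon> n \<le> 1 / 2"
    and a: "ss_unif_adj smul I Mn (\<lambda>_. M) < a" and b: "ss_unif_adj smul I Nn (\<lambda>_. N) < b"
  shows "1 / 2 \<le> 2 * (min a b + c * (a + b))"
proof -
  have M: "subspace M" and N: "subspace N" and fin: "edim smul (M \<inter> N) < \<infinity>"
    using lsf by (simp_all add: lower_semi_fredholm_def closed_subspace_def lower_defect_def)
  have K: "\<forall>n\<in>I'. closed_subspace smul (Domain (G n)) \<and> Domain (G n) \<subseteq> Mn n \<and> edim smul (Domain (G n)) = \<infinity>"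
  proof
    fix n assume n: "n \<in> I'"
    have "near_graph (\<epsilon> n) ((G n)\<inverse>)" using G[OF n] by (intro near_graph_converse) blast
    then have "subspace ((G n)\<inverse> `` UNIV)" "closed ((G n)\<inverse> `` UNIV)"
      using subspace_near_graph_Image closed_near_graph_Image[OF _ eps(2) closed_UNIV] by auto
    moreover have "(G n)\<inverse> `` UNIV = Domain (G n)" by blast
    ultimately show "closed_subspace smul (Domain (G n)) \<and> Domain (G n) \<subseteq> Mn n \<and> edim smul (Domain (G n)) = \<infinity>"
      using G[OF n] by (auto simp: closed_subspace_def)
  qed
  obtain J L where J: "J \<subseteq> I'" "infinite J"
      and L: "\<forall>n\<in>J. closed_subspace smul (L n) \<and> L n \<subseteq> Domain (G n) \<and> edim smul (L n) = \<infinity>"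
      and adjL: "lower_uniformly_adjusted J L (\<lambda>_. M) a" and a0: "0 < a"
    by (rule ss_unif_adj_obtain[OF a subspace_0[OF M] I K])
  have GJ: "near_graph (\<epsilon> n) (G n)" "G n \<subseteq> Mn n \<times> Nn n" if "n \<in> J" for n using G J(1) that by blast+
  have image: "\<forall>n\<in>J. closed_subspace smul (G n `` L n) \<and> G n `` L n \<subseteq> Nn n \<and> edim smul (G n `` L n) = \<infinity>"
  proof (intro ballI conjI)
    fix n assume n: "n \<in> J"
    show "closed_subspace smul (G n `` L n)"
      using bspec[OF L n] subspace_near_graph_Image[OF GJ(1)[OF n]] closed_near_graph_Image[OF GJ(1)[OF n] eps(2)]
      by (auto simp: closed_subspace_def)
    show "G n `` L n \<subseteq> Nn n" using GJ(2)[OF n] by blast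
    show "edim smul (G n `` L n) = \<infinity>"
      using edim_le_near_graph_Image[OF GJ(1)[OF n], of "L n"] bspec[OF L n] by simp
  qed
  have JI: "J \<subseteq> I" using J I by blast
  obtain J' L' where J': "J' \<subseteq> J" "infinite J'"
      and L': "\<forall>n\<in>J'. closed_subspace smul (L' n) \<and> L' n \<subseteq> G n `` L n \<and> edim smul (L' n) = \<infinity>"
      and adjL': "lower_uniformly_adjusted J' L' (\<lambda>_. N) b" and b0: "0 < b"
    by (rule ss_unif_adj_obtain[OF b subspace_0[OF N] JI J(2) image])
  have L'': "subspace (L' n) \<and> L' n \<subseteq> G n `` L n" if "n \<in> J'" for n
    using bspec[OF L' that] by (simp add: closed_subspace_def)
  have L'dim: "\<forall>\<^sub>F n in along J'. enat p < edim smul (L' n)" for p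
    using L' by (auto simp: eventually_along)
  obtain q where q0: "0 \<le> q" "q < c"
      and q: "\<forall>w\<in>M + N. \<exists>u\<in>M. \<exists>t\<in>M \<inter> N. \<exists>v\<in>N. w = u + t + v \<and> norm u \<le> q * norm w \<and> norm v \<le> q * norm w"
    by (rule phi_approx[OF lsf phi])
  have "1 / 2 \<le> 2 * (min a b + q * (a + b))"
    by (rule near_graph_not_both_adjusted[OF M N fin q0(1) bspec[OF q] GJ(1) eps(1) order_refl J' L'' L'dim adjL adjL'])
  moreover have "q * (a + b) \<le> c * (a + b)"
    using q0(2) a0 b0 by (intro mult_right_mono) auto
  ultimately show ?thesis by simp
qed

end

text \<open>Continuity at d = 0. The two adjustment constants and \<open>phi\<close> are infima, so
  each has to be replaced by a slightly larger number.\<close>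

lemma perturbation_room:
  fixes a b r :: real
  assumes less: "2 * (min a b + r * (a + b)) < 1 / 2"
  obtains d where "d > 0" "2 * (min (a + d) (b + d) + (r + d) * ((a + d) + (b + d))) < 1 / 2"
proof -
  define g where "g d = 2 * (min (a + d) (b + d) + (r + d) * ((a + d) + (b + d)))" for d
  have "(g \<longlongrightarrow> g 0) (at_right 0)"
    unfolding g_def by (intro tendsto_intros)
  moreover have "g 0 < 1 / 2" using less by (simp add: g_def)
  ultimately have "\<forall>\<^sub>F d in at_right 0. g d < 1 / 2" by (rule order_tendstoD)
  moreover have "\<forall>\<^sub>F d :: real in at_right 0. d > 0" by (rule eventually_at_right_less)
  ultimately have "\<forall>\<^sub>F d in at_right 0. g d < 1 / 2 \<and> d > 0" by (rule eventually_conj)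
  then obtain d where "g d < 1 / 2" "d > 0"
    using eventually_happens' trivial_limit_at_right_real by blast
  then show ?thesis using that by (simp add: g_def)
qed

context banach_scaling
begin

text \<open>A diagonal choice: the k-th bad index fails either by not being lower semi-Fredholm or
  by having defect above k. In both cases there is a relation with domain of dimension at least k,
  so the dimensions tend to infinity along the bad indices.\<close>

lemma lower_semi_fredholm_fss_perturbation:
  assumes lsf: "lower_semi_fredholm smul M N"
    and Mn: "\<And>n. n \<in> I \<Longrightarrow> closed_subspace smul (Mn n)"
    and Nn: "\<And>n. n \<in> I \<Longrightarrow> closed_subspace smul (Nn n)"
    and less: "2 * (min a b + phi smul M N * (a + b)) < 1 / 2"
    and a: "a = fss_unif_adj smul I Mn (\<lambda>_. M)" and b: "b = fss_unif_adj smul I Nn (\<lambda>_. N)"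
  obtains p where "\<forall>\<^sub>F n in along I. lower_semi_fredholm smul (Mn n) (Nn n) \<and>
      lower_defect smul (Mn n) (Nn n) \<le> enat p"
proof -
  have "\<exists>p. \<forall>\<^sub>F n in along I. lower_semi_fredholm smul (Mn n) (Nn n) \<and>
      lower_defect smul (Mn n) (Nn n) \<le> enat p"
  proof (rule ccontr)
    define ok where "ok p n \<longleftrightarrow> lower_semi_fredholm smul (Mn n) (Nn n) \<and>
        lower_defect smul (Mn n) (Nn n) \<le> enat p" for p n
    assume "\<nexists>p. \<forall>\<^sub>F n in along I. lower_semi_fredholm smul (Mn n) (Nn n) \<and>
      lower_defect smul (Mn n) (Nn n) \<le> enat p"
    then have bad: "\<exists>n\<ge>m. n \<in> I \<and> \<not> ok p n" for p m
      unfolding eventually_along ok_def by blast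
    have "\<exists>r. \<forall>k. (r k \<in> I \<and> \<not> ok k (r k)) \<and> r k < r (Suc k)"
    proof (rule dependent_nat_choice)
      show "\<exists>n. n \<in> I \<and> \<not> ok 0 n" using bad by blast
      show "\<exists>n. (n \<in> I \<and> \<not> ok (Suc k) n) \<and> m < n" for m k
        using bad[of "Suc m" "Suc k"] by (auto simp: Suc_le_eq)
    qed
    then obtain r where r: "\<And>k. r k \<in> I" "\<And>k. \<not> ok k (r k)" "\<And>k. r k < r (Suc k)" by blast
    have mono: "strict_mono r" using r(3) by (simp add: strict_mono_Suc_iff)
    then have inj: "inj r" by (rule strict_mono_imp_inj_on)
    define e where "e n = inverse (real (Suc n))" for n
    have e: "e n > 0" for n by (simp add: e_def)
    have eps: "e \<longlonglongrightarrow> 0" unfolding e_def by (rule LIMSEQ_inverse_real_of_nat)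
    have "\<exists>G. near_graph (e n) G \<and> G \<subseteq> Mn n \<times> Nn n \<and> enat (inv r n) \<le> edim smul (Domain G)"
      if n: "n \<in> range r" for n
    proof -
      have nI: "n \<in> I" and not_ok: "\<not> ok (inv r n) n" using n r inj by auto
      note cl = Mn[OF nI] Nn[OF nI]
      show ?thesis
      proof (cases "lower_semi_fredholm smul (Mn n) (Nn n)")
        case True
        then have "enat (inv r n) \<le> edim smul (Mn n \<inter> Nn n)"
          using not_ok by (simp add: ok_def lower_defect_def)
        moreover have "near_graph (e n) (Id_on (Mn n \<inter> Nn n))"
          using cl e[of n] by (intro near_graph_Id_on) (auto simp: closed_subspace_def intro: subspace_inter)
        ultimately show ?thesis
          by (intro exI[of _ "Id_on (Mn n \<inter> Nn n)"]) (auto simp: Domain_Id_on)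
      next
        case False
        then show ?thesis
          using near_graph_exists_if_not_lower_semi_fredholm[OF cl False e] by (metis enat_ord_simps(3))
      qed
    qed
    then obtain G where G: "\<And>n. n \<in> range r \<Longrightarrow> near_graph (e n) (G n) \<and> G n \<subseteq> Mn n \<times> Nn n"
        "\<And>n. n \<in> range r \<Longrightarrow> enat (inv r n) \<le> edim smul (Domain (G n))"
      by metis
    have dim: "\<forall>\<^sub>F n in along (range r). enat p < edim smul (Domain (G n))" for p
      unfolding eventually_along
    proof (intro exI[of _ "r (Suc p)"] ballI impI)
      fix n assume n: "n \<in> range r" "n \<ge> r (Suc p)"
      then obtain k where k: "n = r k" by blast
      then have "p < k" using n(2) strict_mono_less_eq[OF mono] by simp
      then have "enat p < enat (inv r n)" using k inj by simp
      then show "enat p < edim smul (Domain (G n))" using G(2)[OF n(1)] by (rule less_le_trans)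
    qed
    have rI: "range r \<subseteq> I" "infinite (range r)" using r(1) range_inj_infinite[OF inj] by auto
    obtain d where d: "d > 0" "2 * (min (a + d) (b + d) + (phi smul M N + d) * ((a + d) + (b + d))) < 1 / 2"
      by (rule perturbation_room[OF less])
    have "fss_unif_adj smul I Mn (\<lambda>_. M) < a + d" "fss_unif_adj smul I Nn (\<lambda>_. N) < b + d"
      using d(1) by (simp_all add: a b)
    from fss_unif_adj_near_graph[OF lsf _ rI G(1) eps dim this, of "phi smul M N + d"] d
    show False by simp
  qed
  then show ?thesis using that by blast
qed

lemma lower_semi_fredholm_ss_perturbation:
  assumes lsf: "lower_semi_fredholm smul M N"
    and Mn: "\<And>n. n \<in> I \<Longrightarrow> closed_subspace smul (Mn n)"
    and Nn: "\<And>n. n \<in> I \<Longrightarrow> closed_subspace smul (Nn n)"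
    and less: "2 * (min a b + phi smul M N * (a + b)) < 1 / 2"
    and a: "a = ss_unif_adj smul I Mn (\<lambda>_. M)" and b: "b = ss_unif_adj smul I Nn (\<lambda>_. N)"
  shows "\<forall>\<^sub>F n in along I. lower_semi_fredholm smul (Mn n) (Nn n)"
proof (rule ccontr)
  define J where "J = {n\<in>I. \<not> lower_semi_fredholm smul (Mn n) (Nn n)}"
  assume "\<not> ?thesis"
  then have "\<exists>n\<ge>m. n \<in> J" for m
    unfolding eventually_along J_def by blast
  then have J: "J \<subseteq> I" "infinite J"
    by (auto simp: J_def infinite_nat_iff_unbounded_le)
  \<comment> \<open>The additional shift makes the first value 1 / 2, the bound under which images
    of closed sets are closed.\<close>
  define e where "e n = inverse (real (Suc (Suc n)))" for n
  have e: "e n > 0" "e n \<le> 1 / 2" for n by (simp_all add: e_def field_simps)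
  have eps: "e \<longlonglongrightarrow> 0"
    unfolding e_def by (rule LIMSEQ_Suc[OF LIMSEQ_inverse_real_of_nat])
  have "\<exists>G. near_graph (e n) G \<and> G \<subseteq> Mn n \<times> Nn n \<and> edim smul (Domain G) = \<infinity>" if n: "n \<in> J" for n
  proof -
    have "n \<in> I" "\<not> lower_semi_fredholm smul (Mn n) (Nn n)" using n by (auto simp: J_def)
    from near_graph_exists_if_not_lower_semi_fredholm[OF Mn[OF this(1)] Nn[OF this(1)] this(2) e(1)]
    show ?thesis by blast
  qed
  then obtain G where G: "\<And>n. n \<in> J \<Longrightarrow>
      near_graph (e n) (G n) \<and> G n \<subseteq> Mn n \<times> Nn n \<and> edim smul (Domain (G n)) = \<infinity>"
    by metis
  obtain d where d: "d > 0" "2 * (min (a + d) (b + d) + (phi smul M N + d) * ((a + d) + (b + d))) < 1 / 2"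
    by (rule perturbation_room[OF less])
  have "ss_unif_adj smul I Mn (\<lambda>_. M) < a + d" "ss_unif_adj smul I Nn (\<lambda>_. N) < b + d"
    using d(1) by (simp_all add: a b)
  from ss_unif_adj_near_graph[OF lsf _ J G eps e(2) this, of "phi smul M N + d"] d
  show False by simp
qed

end

theorem theorem4p2p2:
  fixes smul :: "'k::{real_normed_field, heine_borel} \<Rightarrow> 'a::banach \<Rightarrow> 'a"
    and M N :: "'a set"
    and I :: "nat set"
    and Mn Nn :: "nat \<Rightarrow> 'a set"
  assumes "banach_scaling smul"
    and "lower_semi_fredholm smul M N"
    and "infinite I"
    and "\<And>n. n \<in> I \<Longrightarrow> closed_subspace smul (Mn n) \<and> Mn n \<noteq> {0}"
    and "\<And>n. n \<in> I \<Longrightarrow> closed_subspace smul (Nn n) \<and> Nn n \<noteq> {0}"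
  defines "fss_M \<equiv> fss_unif_adj smul I Mn (\<lambda>_. M)"
    and "fss_N \<equiv> fss_unif_adj smul I Nn (\<lambda>_. N)"
    and "ss_M \<equiv> ss_unif_adj smul I Mn (\<lambda>_. M)"
    and "ss_N \<equiv> ss_unif_adj smul I Nn (\<lambda>_. N)"
  shows "(2 * (min fss_M fss_N + phi smul M N * (fss_M + fss_N)) < 1 / 2 \<longrightarrow>
            (\<forall>\<^sub>F n in along I. lower_semi_fredholm smul (Mn n) (Nn n)) \<and>
            Limsup (along I) (\<lambda>n. lower_defect smul (Mn n) (Nn n)) < \<infinity>) \<and>
         (2 * (min ss_M ss_N + phi smul M N * (ss_M + ss_N)) < 1 / 2 \<longrightarrow>
            (\<forall>\<^sub>F n in along I. lower_semi_fredholm smul (Mn n) (Nn n)))"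
proof -
  interpret banach_scaling smul by fact
  have Mn: "closed_subspace smul (Mn n)" and Nn: "closed_subspace smul (Nn n)" if "n \<in> I" for n
    using assms(4,5) that by auto
  show ?thesis
  proof (intro conjI impI)
    assume "2 * (min fss_M fss_N + phi smul M N * (fss_M + fss_N)) < 1 / 2"
    from lower_semi_fredholm_fss_perturbation[OF assms(2) Mn Nn this fss_M_def[THEN meta_eq_to_obj_eq]
        fss_N_def[THEN meta_eq_to_obj_eq]]
    obtain p where p: "\<forall>\<^sub>F n in along I. lower_semi_fredholm smul (Mn n) (Nn n) \<and>
        lower_defect smul (Mn n) (Nn n) \<le> enat p"
      by blast
    show "\<forall>\<^sub>F n in along I. lower_semi_fredholm smul (Mn n) (Nn n)"
      using p by (rule eventually_mono) blast
    have "Limsup (along I) (\<lambda>n. lower_defect smul (Mn n) (Nn n)) \<le> enat p"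
      by (intro Limsup_bounded eventually_mono[OF p]) blast
    also have "\<dots> < \<infinity>" by simp
    finally show "Limsup (along I) (\<lambda>n. lower_defect smul (Mn n) (Nn n)) < \<infinity>" .
  next
    assume "2 * (min ss_M ss_N + phi smul M N * (ss_M + ss_N)) < 1 / 2"
    from lower_semi_fredholm_ss_perturbation[OF assms(2) Mn Nn this ss_M_def[THEN meta_eq_to_obj_eq]
        ss_N_def[THEN meta_eq_to_obj_eq]]
    show "\<forall>\<^sub>F n in along I. lower_semi_fredholm smul (Mn n) (Nn n)" by simp
  qed
qed

end
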